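(* Let $q\ge 3$ be a prime power and let $X\subset\mathbb{P}^3(\mathbb{F}_q)$ be an elliptic quadric. The second and third weights of the code $C_2(X)$ are respectively $$w_2=q(q-2),\qquad w_3=(q-1)^2.$$
   Context: A quadric in $\mathbb{P}^3(\mathbb{F}_q)$ is the zero set $Z(f)$ of a nonzero form $f$ of degree 2 in $x_0,\dots,x_3$ over $\mathbb{F}_q$. It is non-degenerate if it has rank 4, the rank being the smallest number of indeterminates appearing in $f$ under any linear change of coordinates. An elliptic quadric is a non-degenerate quadric with $q^2+1$ points over $\mathbb{F}_q$. Let $F$ be the $\mathbb{F}_q$-vector space of forms of degree 2 in $x_0,\dots,x_3$ over $\mathbb{F}_q$ (including $0$). Each point $x\in\mathbb{P}^3(\mathbb{F}_q)$ is represented by its unique homogeneous coordinate vector whose first nonzero coordinate equals $1$. The functional code $C_2(X)$ is the image of the linear map $c:F\to\mathbb{F}_q^{|X|}$, $c(f)=(f(x_0,\dots,x_3))_{x\in X}$. The weight of a codeword is its number of nonzero coordinates. The first, second and third weights of the code are the smallest, second smallest and third smallest nonzero values taken by the weight. *)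

theory Defs
  imports "HOL-Analysis.Analysis" "HOL-Library.Poly_Mapping" "HOL-Library.Numeral_Type"
begin

(* Polynomials in x_0, ..., x_3: a monomial is a finitely supported exponent function.
   The index type 4 has the elements 0 < 1 < 2 < 3. *)
type_synonym 'a poly4 = "(4 \<Rightarrow>\<^sub>0 nat) \<Rightarrow>\<^sub>0 'a"

definition forms2 :: "'a::comm_ring_1 poly4 set" where
  "forms2 = {f. \<forall>m \<in> Poly_Mapping.keys f. (\<Sum>i\<in>UNIV. Poly_Mapping.lookup m i) = 2}"

definition eval_form :: "'a::comm_ring_1 poly4 \<Rightarrow> 'a ^ 4 \<Rightarrow> 'a" where
  "eval_form f v = (\<Sum>m\<in>Poly_Mapping.keys f. Poly_Mapping.lookup f m * (\<Prod>i\<in>UNIV. (v $ i) ^ Poly_Mapping.lookup m i))"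

definition const4 :: "'a::comm_ring_1 \<Rightarrow> 'a poly4" where
  "const4 c = Poly_Mapping.single 0 c"

definition var4 :: "4 \<Rightarrow> 'a::comm_ring_1 poly4" where
  "var4 i = Poly_Mapping.single (Poly_Mapping.single i 1) 1"

(* The polynomial f(A x): each x_i is replaced by the linear form given by row i of A. *)
definition change_coords :: "'a::comm_ring_1 ^ 4 ^ 4 \<Rightarrow> 'a poly4 \<Rightarrow> 'a poly4" where
  "change_coords A f =
     (\<Sum>m\<in>Poly_Mapping.keys f. const4 (Poly_Mapping.lookup f m) *
        (\<Prod>i\<in>UNIV. (\<Sum>j\<in>UNIV. const4 (A $ i $ j) * var4 j) ^ Poly_Mapping.lookup m i))"

definition indets :: "'a::comm_ring_1 poly4 \<Rightarrow> 4 set" where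
  "indets f = (\<Union>m\<in>Poly_Mapping.keys f. Poly_Mapping.keys m)"

definition form_rank :: "'a::field poly4 \<Rightarrow> nat" where
  "form_rank f = (LEAST r. \<exists>A. invertible A \<and> card (indets (change_coords A f)) = r)"

(* Each point of projective 3-space is identified with its homogeneous coordinate vector
   whose first nonzero coordinate is 1. *)
definition proj3 :: "('a::field ^ 4) set" where
  "proj3 = {v. \<exists>i. v $ i = 1 \<and> (\<forall>j<i. v $ j = 0)}"

definition zero_set :: "'a::field poly4 \<Rightarrow> ('a ^ 4) set" where
  "zero_set f = {x \<in> proj3. eval_form f x = 0}"

definition elliptic_quadric :: "('a::{field,finite} ^ 4) set \<Rightarrow> bool" where
  "elliptic_quadric X \<longleftrightarrow>
     (\<exists>f \<in> forms2. f \<noteq> 0 \<and> form_rank f = 4 \<and> X = zero_set f) \<and> card X = CARD('a)^2 + 1"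

(* Codewords are vectors indexed by X, encoded as functions that are undefined outside X. *)
definition code2 :: "('a::field ^ 4) set \<Rightarrow> ('a ^ 4 \<Rightarrow> 'a) set" where
  "code2 X = (\<lambda>f. restrict (eval_form f) X) ` forms2"

definition weight :: "('a::field ^ 4) set \<Rightarrow> ('a ^ 4 \<Rightarrow> 'a) \<Rightarrow> nat" where
  "weight X w = card {x \<in> X. w x \<noteq> 0}"

definition nonzero_weights :: "('a::field ^ 4) set \<Rightarrow> nat set" where
  "nonzero_weights X = weight X ` code2 X - {0}"

(* w is the k-th smallest nonzero weight, counting from k = 1. *)
definition is_kth_weight :: "('a::field ^ 4) set \<Rightarrow> nat \<Rightarrow> nat \<Rightarrow> bool" where
  "is_kth_weight X k w \<longleftrightarrow>
     w \<in> nonzero_weights X \<and> card {v \<in> nonzero_weights X. v < w} + 1 = k"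

end

theory Submission
  imports Defs
begin

text \<open>Zeros are counted among vectors of the 4-dimensional space rather than among points. For a
  quadratic map Q and a singular vector a, counting the t with \<open>Q (v + t a) = 0\<close> over all v relates the
  zeros of Q to those on the hyperplane polar to a. For the elliptic form, the zeros polar to a are then
  the multiples of a, and a plane meets X in at most \<open>q + 1\<close> points, with equality unless it is tangent
  or disjoint from X. If a quadric not containing X met X in more than \<open>2 q + 2\<close> points, some member
  of the pencil it spans with X would have so many zeros that it is a pair of planes, and two plane
  sections have at most \<open>2 q + 2\<close> points, a contradiction. Hence the smallest possible nonzero weight is
  \<open>q\<^sup>2 - 2 q - 1\<close>, and this weight and the next two integers are attained by pairs of secant planes
  meeting in a line external, tangent, or secant to X, respectively.\<close>

subsection \<open>Evaluation of polynomials\<close>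

lemma eval_form_add: "eval_form (f + g) v = eval_form f v + eval_form g v"
  unfolding eval_form_def
  by (rule setsum_keys_plus_distrib) (simp_all add: algebra_simps)

lemma eval_form_0 [simp]: "eval_form 0 v = 0"
  by (simp add: eval_form_def)

lemma eval_form_sum: "eval_form (sum f S) v = (\<Sum>s\<in>S. eval_form (f s) v)"
  by (induction S rule: infinite_finite_induct) (simp_all add: eval_form_add)

lemma eval_form_single:
  "eval_form (Poly_Mapping.single m c) v = c * (\<Prod>i\<in>UNIV. (v $ i) ^ Poly_Mapping.lookup m i)"
  by (cases "c = 0") (simp_all add: eval_form_def)

lemma poly_mapping_expansion:
  "f = (\<Sum>m\<in>Poly_Mapping.keys f. Poly_Mapping.single m (Poly_Mapping.lookup f m))"
  by (rule poly_mapping_eqI)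
    (simp add: lookup_sum lookup_single when_def in_keys_iff)

lemma eval_form_mult: "eval_form (f * g) v = eval_form f v * eval_form g v"
proof -
  have "f * g = (\<Sum>m\<in>Poly_Mapping.keys f. \<Sum>n\<in>Poly_Mapping.keys g.
      Poly_Mapping.single (m + n) (Poly_Mapping.lookup f m * Poly_Mapping.lookup g n))"
    by (subst poly_mapping_expansion[of f], subst poly_mapping_expansion[of g])
      (simp add: sum_product mult_single)
  then show ?thesis
    by (simp add: eval_form_sum eval_form_single lookup_add power_add prod.distrib)
      (simp add: eval_form_def sum_product algebra_simps)
qed

lemma eval_form_const4 [simp]: "eval_form (const4 c) v = c"
  by (simp add: const4_def eval_form_single)

lemma eval_form_1 [simp]: "eval_form 1 v = 1"
  using eval_form_const4[of 1 v] by (simp add: const4_def)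

lemma eval_form_var4 [simp]: "eval_form (var4 i) v = v $ i"
proof -
  have "(v $ k) ^ Poly_Mapping.lookup (Poly_Mapping.single i 1) k = (if k = i then v $ i else 1)" for k
    by (simp add: lookup_single when_def)
  then show ?thesis
    by (simp add: var4_def eval_form_single)
qed

lemma eval_form_power: "eval_form (f ^ n) v = eval_form f v ^ n"
  by (induction n) (simp_all add: eval_form_mult)

lemma eval_form_prod: "eval_form (prod f S) v = (\<Prod>s\<in>S. eval_form (f s) v)"
  by (induction S rule: infinite_finite_induct) (simp_all add: eval_form_mult)

lemma eval_form_change_coords: "eval_form (change_coords A f) v = eval_form f (A *v v)"
  by (simp add: change_coords_def eval_form_sum eval_form_mult eval_form_prod eval_form_power
      matrix_vector_mult_def) (simp add: eval_form_def)

subsection \<open>Homogeneous polynomials\<close>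

definition homogeneous :: "nat \<Rightarrow> 'a::comm_ring_1 poly4 \<Rightarrow> bool" where
  "homogeneous d f \<longleftrightarrow> (\<forall>m\<in>Poly_Mapping.keys f. (\<Sum>i\<in>UNIV. Poly_Mapping.lookup m i) = d)"

lemma forms2_iff: "f \<in> forms2 \<longleftrightarrow> homogeneous 2 f"
  by (simp add: forms2_def homogeneous_def)

lemma homogeneous_0 [simp]: "homogeneous d 0"
  by (simp add: homogeneous_def)

lemma homogeneous_add: "homogeneous d f \<Longrightarrow> homogeneous d g \<Longrightarrow> homogeneous d (f + g)"
  using keys_add[of f g] by (auto simp: homogeneous_def)

lemma homogeneous_sum: "(\<And>s. s \<in> S \<Longrightarrow> homogeneous d (f s)) \<Longrightarrow> homogeneous d (sum f S)"
  by (induction S rule: infinite_finite_induct) (simp_all add: homogeneous_add)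

lemma homogeneous_mult:
  assumes "homogeneous d f" "homogeneous e g"
  shows "homogeneous (d + e) (f * g)"
  unfolding homogeneous_def
proof
  fix m assume "m \<in> Poly_Mapping.keys (f * g)"
  then obtain a b where "m = a + b" "a \<in> Poly_Mapping.keys f" "b \<in> Poly_Mapping.keys g"
    using keys_mult[of f g] by blast
  then show "(\<Sum>i\<in>UNIV. Poly_Mapping.lookup m i) = d + e"
    using assms by (simp add: homogeneous_def lookup_add sum.distrib)
qed

lemma homogeneous_const4 [simp]: "homogeneous 0 (const4 c)"
  by (auto simp: homogeneous_def const4_def)

lemma homogeneous_1 [simp]: "homogeneous 0 1"
  using homogeneous_const4[of 1] by (simp add: const4_def)

lemma homogeneous_var4 [simp]: "homogeneous 1 (var4 i)"
  by (auto simp: homogeneous_def var4_def lookup_single when_def)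

lemma homogeneous_power: "homogeneous d f \<Longrightarrow> homogeneous (n * d) (f ^ n)"
  by (induction n) (simp_all add: homogeneous_mult)

lemma homogeneous_prod:
  assumes "\<And>s. s \<in> S \<Longrightarrow> homogeneous (d s) (f s)" "finite S"
  shows "homogeneous (sum d S) (prod f S)"
  using assms(2,1) by (induction S rule: finite_induct) (simp_all add: homogeneous_mult)

lemma change_coords_forms2:
  assumes "f \<in> forms2" shows "change_coords A f \<in> forms2"
  unfolding forms2_iff change_coords_def
proof (rule homogeneous_sum)
  fix m assume m: "m \<in> Poly_Mapping.keys f"
  let ?l = "\<lambda>i. \<Sum>j\<in>UNIV. const4 (A $ i $ j) * var4 j"
  have l: "homogeneous 1 (?l i)" for i
    by (intro homogeneous_sum) (metis homogeneous_mult homogeneous_const4 homogeneous_var4 add_0)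
  have "homogeneous (Poly_Mapping.lookup m i) (?l i ^ Poly_Mapping.lookup m i)" for i
    using homogeneous_power[OF l[of i], of "Poly_Mapping.lookup m i"] by simp
  then have "homogeneous (\<Sum>i\<in>UNIV. Poly_Mapping.lookup m i)
      (\<Prod>i\<in>UNIV. ?l i ^ Poly_Mapping.lookup m i)"
    by (intro homogeneous_prod) auto
  moreover have "(\<Sum>i\<in>UNIV. Poly_Mapping.lookup m i) = 2"
    using assms m by (simp add: forms2_def)
  ultimately show "homogeneous 2 (const4 (Poly_Mapping.lookup f m) * (\<Prod>i\<in>UNIV. ?l i ^ Poly_Mapping.lookup m i))"
    using homogeneous_mult[OF homogeneous_const4] by fastforce
qed

lemma degree_Suc_monomial:
  fixes m :: "'i::finite \<Rightarrow>\<^sub>0 nat"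
  assumes "(\<Sum>i\<in>UNIV. Poly_Mapping.lookup m i) = Suc d"
  obtains i n where "m = Poly_Mapping.single i 1 + n" "(\<Sum>i\<in>UNIV. Poly_Mapping.lookup n i) = d"
proof -
  obtain i where i: "Poly_Mapping.lookup m i \<noteq> 0"
    using assms by (metis Zero_not_Suc sum.neutral)
  \<comment> \<open>Subtraction of exponents is truncated, but nothing is lost because the exponent
    of \<open>i\<close> in \<open>m\<close> is positive.\<close>
  define n where "n = m - Poly_Mapping.single i 1"
  have m: "m = Poly_Mapping.single i 1 + n"
    using i by (intro poly_mapping_eqI) (auto simp: n_def lookup_add lookup_minus lookup_single when_def)
  have "(\<Sum>k\<in>UNIV. Poly_Mapping.lookup (Poly_Mapping.single i (1::nat)) k) = 1"
    by (simp add: lookup_single when_def)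
  then have "(\<Sum>i\<in>UNIV. Poly_Mapping.lookup n i) = d"
    using assms unfolding m lookup_add sum.distrib by simp
  with m that show thesis by blast
qed

lemma degree_2_monomial:
  fixes m :: "'i::finite \<Rightarrow>\<^sub>0 nat"
  assumes "(\<Sum>i\<in>UNIV. Poly_Mapping.lookup m i) = 2"
  obtains i j where "m = Poly_Mapping.single i 1 + Poly_Mapping.single j 1"
proof -
  obtain i n where m: "m = Poly_Mapping.single i 1 + n" and n: "(\<Sum>i\<in>UNIV. Poly_Mapping.lookup n i) = 1"
    using degree_Suc_monomial[of m 1] assms by (auto simp: numeral_2_eq_2)
  obtain j k where n': "n = Poly_Mapping.single j 1 + k" and k: "(\<Sum>i\<in>UNIV. Poly_Mapping.lookup k i) = 0"
    using degree_Suc_monomial[of n 0] n by auto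
  have "k = 0" using k by (intro poly_mapping_eqI) simp
  with m n' that show thesis by simp
qed

lemma eval_form_quadratic_monomial:
  "eval_form (Poly_Mapping.single (Poly_Mapping.single i 1 + Poly_Mapping.single j 1) c) v = c * (v $ i * v $ j)"
proof -
  have "Poly_Mapping.single (Poly_Mapping.single i 1 + Poly_Mapping.single j 1) c = const4 c * (var4 i * var4 j)"
    by (simp add: const4_def var4_def mult_single)
  then show ?thesis by (simp add: eval_form_mult)
qed

subsection \<open>Quadratic maps and their polar forms\<close>

definition linear_form :: "('a::comm_ring_1 ^ 'n \<Rightarrow> 'a) \<Rightarrow> bool" where
  "linear_form l \<longleftrightarrow> (\<forall>u v. l (u + v) = l u + l v) \<and> (\<forall>c v. l (c *s v) = c * l v)"

text \<open>The polar bilinear form without a factor 1/2, so that characteristic 2 is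
  covered.\<close>

definition polar :: "('a::comm_ring_1 ^ 'n \<Rightarrow> 'a) \<Rightarrow> 'a ^ 'n \<Rightarrow> 'a ^ 'n \<Rightarrow> 'a" where
  "polar Q u v = Q (u + v) - Q u - Q v"

text \<open>Linearity in one argument gives bilinearity, since \<open>polar\<close> is
  symmetric.\<close>

definition quadratic_map :: "('a::comm_ring_1 ^ 'n \<Rightarrow> 'a) \<Rightarrow> bool" where
  "quadratic_map Q \<longleftrightarrow> (\<forall>c v. Q (c *s v) = c\<^sup>2 * Q v) \<and> (\<forall>u. linear_form (polar Q u))"

lemma linear_form_simps:
  assumes "linear_form l"
  shows linear_form_add: "l (u + v) = l u + l v"
    and linear_form_scale: "l (c *s v) = c * l v"
    and linear_form_zero: "l 0 = 0"
    and linear_form_minus: "l (- v) = - l v"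
    and linear_form_diff: "l (u - v) = l u - l v"
proof -
  show add: "l (u + v) = l u + l v" for u v
    using assms by (simp add: linear_form_def)
  show scale: "l (c *s v) = c * l v" for c v
    using assms by (simp add: linear_form_def)
  show "l 0 = 0" using scale[of 0 0] by simp
  show minus: "l (- v) = - l v" for v using scale[of "-1" v] by (simp add: vector_smult_lneg)
  show "l (u - v) = l u - l v" using add[of u "- v"] minus[of v] by simp
qed

lemma linear_form_component: "linear_form (\<lambda>v. v $ i)"
  by (simp add: linear_form_def)

lemma linear_form_comb:
  assumes "linear_form l" "linear_form m"
  shows "linear_form (\<lambda>v. c * l v + d * m v)"
  using assms by (simp add: linear_form_def algebra_simps)

lemma linear_form_subtract:
  assumes "linear_form l" "linear_form m"
  shows "linear_form (\<lambda>v. l v - m v)"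
  using linear_form_comb[OF assms, of 1 "-1"] by simp

lemma linear_form_expansion:
  fixes l :: "'a::comm_ring_1 ^ 'n \<Rightarrow> 'a"
  assumes "linear_form l"
  shows "l v = (\<Sum>i\<in>UNIV. v $ i * l (axis i 1))"
proof -
  have "l (sum w S) = (\<Sum>i\<in>S. l (w i))" for w :: "'n \<Rightarrow> 'a ^ 'n" and S
    by (induction S rule: infinite_finite_induct)
      (simp_all add: linear_form_zero[OF assms] linear_form_add[OF assms])
  then have "l (\<Sum>i\<in>UNIV. v $ i *s axis i 1) = (\<Sum>i\<in>UNIV. v $ i * l (axis i 1))"
    by (simp add: linear_form_scale[OF assms])
  then show ?thesis by (simp add: basis_expansion)
qed

lemma quadratic_map_scale: "quadratic_map Q \<Longrightarrow> Q (c *s v) = c\<^sup>2 * Q v"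
  by (simp add: quadratic_map_def)

lemma linear_form_polar: "quadratic_map Q \<Longrightarrow> linear_form (polar Q u)"
  by (simp add: quadratic_map_def)

lemma quadratic_map_zero: "quadratic_map Q \<Longrightarrow> Q 0 = 0"
  using quadratic_map_scale[of Q 0 0] by simp

lemma polar_commute: "polar Q u v = polar Q v u"
  by (simp add: polar_def add.commute)

lemma linear_form_polar_left: "quadratic_map Q \<Longrightarrow> linear_form (\<lambda>u. polar Q u v)"
  using linear_form_polar[of Q v] by (simp add: polar_commute[of Q _ v])

text \<open>The counts along translates rest on this: the number of zeros on a line is a number of
  roots in \<open>t\<close>, and the equation is affine when \<open>v\<close> is singular.\<close>

lemma quadratic_map_line:
  assumes "quadratic_map Q"
  shows "Q (u + t *s v) = Q u + t * polar Q u v + t\<^sup>2 * Q v"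
proof -
  have "Q (u + t *s v) = polar Q u (t *s v) + Q u + Q (t *s v)"
    by (simp add: polar_def)
  then show ?thesis
    using assms by (simp add: quadratic_map_scale linear_form_scale[OF linear_form_polar[OF assms]])
qed

lemma polar_self:
  assumes "quadratic_map Q"
  shows "polar Q v v = 2 * Q v"
proof -
  have "v + v = 2 *s v" by (simp add: vec_eq_iff)
  then show ?thesis
    using quadratic_map_scale[OF assms, of 2 v] by (simp add: polar_def power2_eq_square)
qed

lemma quadratic_map_mult:
  assumes "linear_form l" "linear_form m"
  shows "quadratic_map (\<lambda>v. l v * m v)"
proof -
  have "polar (\<lambda>v. l v * m v) u = (\<lambda>v. l u * m v + m u * l v)" for u
    using assms by (simp add: fun_eq_iff polar_def linear_form_add algebra_simps)
  moreover have "linear_form (\<lambda>v. l u * m v + m u * l v)" for u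
    by (rule linear_form_comb[OF assms(2,1)])
  ultimately show ?thesis
    using assms by (simp add: quadratic_map_def linear_form_scale power2_eq_square)
qed

lemma quadratic_map_comb:
  assumes "quadratic_map P" "quadratic_map Q"
  shows "quadratic_map (\<lambda>v. P v + c * Q v)"
proof -
  have "polar (\<lambda>v. P v + c * Q v) u = (\<lambda>v. 1 * polar P u v + c * polar Q u v)" for u
    by (simp add: fun_eq_iff polar_def algebra_simps)
  then show ?thesis
    using assms linear_form_comb[of "polar P _" "polar Q _" 1 c]
    by (simp add: quadratic_map_def algebra_simps)
qed

lemma quadratic_map_sum:
  assumes "\<And>s. s \<in> S \<Longrightarrow> quadratic_map (Q s)"
  shows "quadratic_map (\<lambda>v. \<Sum>s\<in>S. Q s v)"
  using assms
proof (induction S rule: infinite_finite_induct)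
  case (insert x F)
  then show ?case using quadratic_map_comb[of "Q x" "\<lambda>v. \<Sum>s\<in>F. Q s v" 1] by simp
qed (simp_all add: quadratic_map_def linear_form_def polar_def)

lemma eval_form_expansion:
  "eval_form f v = (\<Sum>m\<in>Poly_Mapping.keys f. eval_form (Poly_Mapping.single m (Poly_Mapping.lookup f m)) v)"
  by (subst poly_mapping_expansion[of f]) (rule eval_form_sum)

lemma forms2_monomial:
  assumes "f \<in> forms2" "m \<in> Poly_Mapping.keys f"
  obtains i j where "m = Poly_Mapping.single i 1 + Poly_Mapping.single j 1"
proof (rule degree_2_monomial)
  show "(\<Sum>i\<in>UNIV. Poly_Mapping.lookup m i) = 2"
    using assms by (simp add: forms2_def)
qed (rule that)

lemma quadratic_map_eval_form:
  assumes "f \<in> forms2"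
  shows "quadratic_map (eval_form f)"
proof -
  have "quadratic_map (eval_form (Poly_Mapping.single m (Poly_Mapping.lookup f m)))"
    if m: "m \<in> Poly_Mapping.keys f" for m
  proof -
    obtain i j where ij: "m = Poly_Mapping.single i 1 + Poly_Mapping.single j 1"
      using forms2_monomial[OF assms m] by blast
    have "linear_form (\<lambda>v. Poly_Mapping.lookup f m * v $ i)"
      by (simp add: linear_form_def algebra_simps)
    from quadratic_map_mult[OF this linear_form_component[of j]]
    show ?thesis
      unfolding ij eval_form_quadratic_monomial by (simp add: mult.assoc)
  qed
  then have "quadratic_map (\<lambda>v. \<Sum>m\<in>Poly_Mapping.keys f. eval_form (Poly_Mapping.single m (Poly_Mapping.lookup f m)) v)"
    by (rule quadratic_map_sum)
  then show ?thesis unfolding eval_form_expansion[of f, symmetric] .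
qed

text \<open>This turns pairs of planes into codewords. The coefficients of each linear factor are
  its values at the axis vectors.\<close>

lemma forms2_product:
  assumes "linear_form l" "linear_form m"
  obtains g where "g \<in> forms2" "\<And>v. eval_form g v = l v * m v"
proof
  let ?p = "\<lambda>k. \<Sum>i\<in>UNIV. var4 i * const4 (k (axis i 1))"
  have "homogeneous (1 + 0) (?p k)" for k
    by (intro homogeneous_sum homogeneous_mult homogeneous_var4 homogeneous_const4)
  then have "homogeneous (1 + 1) (?p l * ?p m)"
    by (intro homogeneous_mult) simp_all
  then show "?p l * ?p m \<in> forms2" by (simp add: forms2_iff numeral_2_eq_2)
  show "eval_form (?p l * ?p m) v = l v * m v" for v
    unfolding linear_form_expansion[OF assms(1), of v] linear_form_expansion[OF assms(2), of v]
    by (simp add: eval_form_mult eval_form_sum)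
qed

subsection \<open>Rank and singular radical vectors\<close>

lemma polar_quadratic_monomial:
  fixes c :: "'a::comm_ring_1" and k l :: 4
  assumes "m = Poly_Mapping.single i 1 + Poly_Mapping.single j (1::nat)"
  shows "polar (eval_form (Poly_Mapping.single m c)) (axis k 1) (axis l 1) =
      c * ((if i = k \<and> j = l then 1 else 0) + (if i = l \<and> j = k then 1 else 0))"
proof -
  have "axis x 1 $ y = (of_bool (y = x) :: 'a)" for x y :: 4
    by (simp add: axis_def)
  then show ?thesis
    unfolding assms polar_def eval_form_quadratic_monomial
    by (cases "i = k"; cases "j = k"; cases "i = l"; cases "j = l") simp_all
qed

lemma single_plus_single_eq_iff:
  fixes i j k l :: 'i
  shows "Poly_Mapping.single i (1::nat) + Poly_Mapping.single j 1 = Poly_Mapping.single k 1 + Poly_Mapping.single l 1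
    \<longleftrightarrow> (i = k \<and> j = l) \<or> (i = l \<and> j = k)" (is "?L = ?R")
proof
  assume L: ?L
  have *: "(1 when i = x) + (1 when j = x) = (1 when k = x) + (1 when l = (x::'i) :: nat)" for x
    using arg_cong[OF L, of "\<lambda>m. Poly_Mapping.lookup m x"]
    by (simp only: lookup_add lookup_single)
  have "i = k \<or> i = l" using *[of i] by (auto simp: when_def split: if_split_asm)
  then show ?R
  proof
    assume "i = k"
    with L have "Poly_Mapping.single j (1::nat) = Poly_Mapping.single l 1" by simp
    then have "j = l" by (metis lookup_single_eq lookup_single_not_eq zero_neq_one)
    with \<open>i = k\<close> show ?R by simp
  next
    assume "i = l"
    with L have "Poly_Mapping.single j (1::nat) = Poly_Mapping.single k 1"
      by (metis add.commute add_left_cancel)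
    then have "j = k" by (metis lookup_single_eq lookup_single_not_eq zero_neq_one)
    with \<open>i = l\<close> show ?R by simp
  qed
next
  assume ?R
  then show ?L by (metis add.commute)
qed

text \<open>The rank is defined through monomials, whereas the counting uses values. Recovering
  coefficients from values, here and in \<open>eval_form_axis\<close>, connects the two.\<close>

lemma polar_eval_form_axis:
  fixes f :: "'a::comm_ring_1 poly4"
  assumes f: "f \<in> forms2" and "k \<noteq> l"
  shows "polar (eval_form f) (axis k 1) (axis l 1) =
    Poly_Mapping.lookup f (Poly_Mapping.single k 1 + Poly_Mapping.single l 1)"
proof -
  let ?m = "Poly_Mapping.single k 1 + Poly_Mapping.single l (1::nat)"
  have "polar (eval_form f) (axis k 1) (axis l 1) = (\<Sum>m\<in>Poly_Mapping.keys f.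
      polar (eval_form (Poly_Mapping.single m (Poly_Mapping.lookup f m))) (axis k 1) (axis l 1))"
    unfolding polar_def by (subst (1 2 3) eval_form_expansion[of f]) (simp add: sum_subtractf)
  also have "\<dots> = (\<Sum>m\<in>Poly_Mapping.keys f. if m = ?m then Poly_Mapping.lookup f m else 0)"
  proof (rule sum.cong[OF refl])
    fix m assume "m \<in> Poly_Mapping.keys f"
    then obtain i j where ij: "m = Poly_Mapping.single i 1 + Poly_Mapping.single j 1"
      using forms2_monomial[OF f] by blast
    show "polar (eval_form (Poly_Mapping.single m (Poly_Mapping.lookup f m))) (axis k 1) (axis l 1)
        = (if m = ?m then Poly_Mapping.lookup f m else 0)"
      unfolding polar_quadratic_monomial[OF ij]
      using \<open>k \<noteq> l\<close> single_plus_single_eq_iff[of i j k l] ij by auto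
  qed
  also have "\<dots> = Poly_Mapping.lookup f ?m"
    by (simp add: in_keys_iff)
  finally show ?thesis .
qed

lemma eval_form_axis:
  fixes f :: "'a::comm_ring_1 poly4"
  assumes f: "f \<in> forms2"
  shows "eval_form f (axis k 1) = Poly_Mapping.lookup f (Poly_Mapping.single k 1 + Poly_Mapping.single k 1)"
proof -
  let ?m = "Poly_Mapping.single k 1 + Poly_Mapping.single k (1::nat)"
  have "eval_form f (axis k 1) = (\<Sum>m\<in>Poly_Mapping.keys f. if m = ?m then Poly_Mapping.lookup f m else 0)"
  proof (subst eval_form_expansion, rule sum.cong[OF refl])
    fix m assume "m \<in> Poly_Mapping.keys f"
    then obtain i j where ij: "m = Poly_Mapping.single i 1 + Poly_Mapping.single j 1"
      using forms2_monomial[OF f] by blast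
    show "eval_form (Poly_Mapping.single m (Poly_Mapping.lookup f m)) (axis k 1)
        = (if m = ?m then Poly_Mapping.lookup f m else 0)"
      unfolding ij eval_form_quadratic_monomial
      using single_plus_single_eq_iff[of i j k k] by (auto simp: axis_def)
  qed
  also have "\<dots> = Poly_Mapping.lookup f ?m"
    by (simp add: in_keys_iff)
  finally show ?thesis .
qed

text \<open>A quadratic monomial containing the variable \<open>k\<close> also contains some
  \<open>l\<close>. Its coefficient is a polar value if \<open>l\<close> differs from
  \<open>k\<close>, and the value of the form at the axis vector otherwise.\<close>

lemma notin_indets:
  fixes f :: "'a::comm_ring_1 poly4"
  assumes f: "f \<in> forms2" and 0: "eval_form f (axis k 1) = 0"
    and p: "\<And>v. polar (eval_form f) (axis k 1) v = 0"
  shows "k \<notin> indets f"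
proof
  assume "k \<in> indets f"
  then obtain m where m: "m \<in> Poly_Mapping.keys f" "k \<in> Poly_Mapping.keys m"
    by (auto simp: indets_def)
  then obtain i j where ij: "m = Poly_Mapping.single i 1 + Poly_Mapping.single j 1"
    using forms2_monomial[OF f] by blast
  have "k = i \<or> k = j"
    using m(2) keys_add[of "Poly_Mapping.single i (1::nat)" "Poly_Mapping.single j 1"] by (auto simp: ij)
  then obtain l where l: "m = Poly_Mapping.single k 1 + Poly_Mapping.single l 1"
    using ij add.commute by metis
  have "Poly_Mapping.lookup f m = 0"
    using eval_form_axis[OF f, of k] polar_eval_form_axis[OF f, of k l] 0 p l by (cases "k = l") simp_all
  then show False using m(1) by (simp add: in_keys_iff)
qed

text \<open>The identity matrix with column \<open>k\<close> replaced by \<open>a\<close> works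
  whenever \<open>a $ k\<close> is nonzero.\<close>

lemma invertible_column:
  fixes a :: "'a::field ^ 'n"
  assumes "a \<noteq> 0"
  obtains A :: "'a ^ 'n ^ 'n" and k where "invertible A" "A *v axis k 1 = a"
proof -
  obtain k where k: "a $ k \<noteq> 0" using assms by (auto simp: vec_eq_iff)
  define A :: "'a ^ 'n ^ 'n" where "A = (\<chi> i j. if j = k then a $ i else if i = j then 1 else 0)"
  have A: "A *v v = v + v $ k *s (a - axis k 1)" for v
  proof (subst vec_eq_iff, rule allI)
    fix i
    have "(A *v v) $ i = (\<Sum>j\<in>UNIV. (if j = k then a $ k * 0 + (a $ i - axis k 1 $ i) * v $ k else 0) + (if j = i then v $ i else 0))"
      unfolding matrix_vector_mult_def A_def
      by (simp, rule sum.cong) (auto simp: axis_def algebra_simps)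
    also have "\<dots> = (v + v $ k *s (a - axis k 1)) $ i"
      by (simp add: sum.distrib algebra_simps)
    finally show "(A *v v) $ i = (v + v $ k *s (a - axis k 1)) $ i" .
  qed
  have "inj ((*v) A)"
  proof (rule injI)
    fix u w assume eq: "A *v u = A *v w"
    \<comment> \<open>Coordinate \<open>k\<close> is only scaled, so \<open>A *v u\<close>
      determines \<open>u $ k\<close>, and the rank-one correction can then be cancelled.\<close>
    have "(A *v v) $ k = a $ k * v $ k" for v
      unfolding A by (simp add: algebra_simps)
    then have "u $ k = w $ k" using eq k by (metis mult_left_cancel)
    then show "u = w" using eq unfolding A by simp
  qed
  then have "invertible A"
    by (simp add: invertible_left_inverse matrix_left_invertible_injective)
  moreover have "A *v axis k 1 = a" unfolding A by simp
  ultimately show thesis by (rule that)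
qed

text \<open>A change of coordinates sending an axis vector to \<open>a\<close> removes the
  corresponding variable. Contrapositively, rank 4 keeps nonzero singular vectors out of the
  radical.\<close>

lemma form_rank_less_4:
  fixes f :: "'a::field poly4"
  assumes f: "f \<in> forms2" and a: "a \<noteq> 0" "eval_form f a = 0" "\<And>v. polar (eval_form f) a v = 0"
  shows "form_rank f < 4"
proof -
  obtain A :: "'a ^ 4 ^ 4" and k where A: "invertible A" and k: "A *v axis k 1 = a"
    using invertible_column[OF a(1)] by blast
  let ?g = "change_coords A f"
  have notin: "k \<notin> indets ?g"
  proof (rule notin_indets[OF change_coords_forms2[OF f]])
    show "eval_form ?g (axis k 1) = 0"
      unfolding eval_form_change_coords k by (rule a(2))
    show "polar (eval_form ?g) (axis k 1) v = 0" for v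
      using a(3)[of "A *v v"]
      unfolding polar_def eval_form_change_coords matrix_vector_right_distrib k .
  qed
  have "card (indets ?g) < card (UNIV :: 4 set)"
  proof (rule psubset_card_mono)
    show "indets ?g \<subset> UNIV" using notin by blast
  qed simp
  moreover have "form_rank f \<le> card (indets ?g)"
    unfolding form_rank_def by (rule Least_le, rule exI[of _ A]) (simp add: A)
  ultimately show ?thesis by simp
qed

subsection \<open>Counting zeros along translates\<close>

text \<open>\<open>S\<close> is the direct sum of the line spanned by \<open>w\<close> and the
  kernel of \<open>l\<close> in \<open>S\<close>.\<close>

lemma card_kernel:
  fixes l :: "'a::{field,finite} ^ 'n \<Rightarrow> 'a"
  assumes S: "vec.subspace S" and l: "linear_form l" and w: "w \<in> S" "l w \<noteq> 0"
  shows "card S = CARD('a) * card {v \<in> S. l v = 0}"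
proof -
  let ?K = "{v \<in> S. l v = 0}"
  have "bij_betw (\<lambda>(t, k). t *s w + k) (UNIV \<times> ?K) S"
  proof (rule bij_betw_imageI)
    show "inj_on (\<lambda>(t, k). t *s w + k) (UNIV \<times> ?K)"
    proof (clarsimp simp: inj_on_def)
      fix t k t' k' assume k: "l k = 0" "l k' = 0" and eq: "t *s w + k = t' *s w + k'"
      have "t * l w = t' * l w"
        using arg_cong[OF eq, of l] k unfolding linear_form_simps[OF l] by simp
      then show "t = t' \<and> k = k'" using w eq by simp
    qed
    show "(\<lambda>(t, k). t *s w + k) ` (UNIV \<times> ?K) = S"
    proof (intro equalityI subsetI)
      fix v assume v: "v \<in> S"
      let ?t = "l v / l w"
      have "v - ?t *s w \<in> ?K"
        using S v w by (simp add: linear_form_simps[OF l] vec.subspace_diff vec.subspace_scale)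
      then show "v \<in> (\<lambda>(t, k). t *s w + k) ` (UNIV \<times> ?K)"
        by (intro image_eqI[of _ _ "(?t, v - ?t *s w)"]) auto
    qed (use S w in \<open>auto intro!: vec.subspace_add vec.subspace_scale\<close>)
  qed
  then have "card ((UNIV :: 'a set) \<times> ?K) = card S" by (rule bij_betw_same_card)
  then show ?thesis by (simp add: card_cartesian_product)
qed

lemma subspace_kernel:
  assumes "vec.subspace S" "linear_form l"
  shows "vec.subspace {v \<in> S. l v = 0}"
  using assms by (auto simp: vec.subspace_def linear_form_simps)

text \<open>Double counting of pairs of \<open>v\<close> and \<open>t\<close>: for fixed
  \<open>t\<close>, translation by \<open>t *s a\<close> permutes \<open>S\<close>.\<close>

lemma sum_card_translates:
  fixes a :: "'a::{field,finite} ^ 'n"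
  assumes S: "vec.subspace S" and a: "a \<in> S"
  shows "(\<Sum>v\<in>S. card {t. P (v + t *s a)}) = CARD('a) * card {v \<in> S. P v}"
proof -
  have "card {v \<in> S. P (v + t *s a)} = card {v \<in> S. P v}" for t
  proof (rule bij_betw_same_card[of "\<lambda>v. v + t *s a"], rule bij_betwI[of _ _ _ "\<lambda>v. v - t *s a"])
  qed (use S a in \<open>auto intro: vec.subspace_add vec.subspace_diff vec.subspace_scale\<close>)
  then show ?thesis
    using sum_multicount_gen[of S UNIV "\<lambda>v t. P (v + t *s a)" "\<lambda>t. card {v \<in> S. P v}"] by simp
qed

text \<open>Since \<open>a\<close> is singular, \<open>Q (v + t *s a)\<close> is affine in
  \<open>t\<close>. It has one root if \<open>polar Q a v\<close> is nonzero; otherwise it is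
  constant and has \<open>q\<close> roots or none.\<close>

lemma singular_vector_count:
  fixes a :: "'a::{field,finite} ^ 'n"
  assumes Q: "quadratic_map Q" and S: "vec.subspace S" and a: "a \<in> S" "Q a = 0"
    and w: "w \<in> S" "polar Q a w \<noteq> 0"
  shows "CARD('a) * card {v \<in> S. Q v = 0} + card {v \<in> S. polar Q a v = 0}
    = card S + CARD('a) * card {v \<in> S. polar Q a v = 0 \<and> Q v = 0}"
proof -
  let ?K = "{v \<in> S. polar Q a v = 0}" and ?R = "{v \<in> S. polar Q a v = 0 \<and> Q v = 0}"
  have *: "card {t. Q (v + t *s a) = 0} =
     (if v \<in> S - ?K then 1 else 0) + (if v \<in> ?R then CARD('a) else 0)" if v: "v \<in> S" for v
  proof (cases "polar Q a v = 0")
    case True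
    then show ?thesis
      using a v by (simp add: quadratic_map_line[OF Q] polar_commute[of Q v a])
  next
    case False
    have "{t. Q (v + t *s a) = 0} = {- Q v / polar Q a v}"
      using a False by (auto simp: quadratic_map_line[OF Q] polar_commute[of Q v a] field_simps add_eq_0_iff)
    with False v show ?thesis by simp
  qed
  have "(\<Sum>v\<in>S. card {t. Q (v + t *s a) = 0}) =
      (\<Sum>v\<in>S. (if v \<in> S - ?K then 1 else 0) + (if v \<in> ?R then CARD('a) else 0))"
    by (rule sum.cong[OF refl *])
  also have "\<dots> = card (S - ?K) + CARD('a) * card ?R"
  proof -
    have "S \<inter> {v. v \<in> S - ?K} = S - ?K" "S \<inter> {v. v \<in> ?R} = ?R" by auto
    then show ?thesis by (simp add: sum.distrib sum.If_cases del: Diff_iff mem_Collect_eq)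
  qed
  also have "card (S - ?K) = card S - card ?K"
    by (rule card_Diff_subset) auto
  finally have "CARD('a) * card {v \<in> S. Q v = 0} = card S - card ?K + CARD('a) * card ?R"
    unfolding sum_card_translates[OF S a(1), of "\<lambda>v. Q v = 0"] .
  moreover have "card ?K \<le> card S" by (rule card_mono) auto
  ultimately show ?thesis by simp
qed

text \<open>Subtracting the equation of a root \<open>s\<close> leaves a linear factor with root
  \<open>- B / C - s\<close>. Unlike completing the square, this works in characteristic 2.\<close>

lemma card_quadratic_roots_le:
  fixes A B C :: "'a::{field,finite}"
  assumes "C \<noteq> 0"
  shows "card {t. A + t * B + t\<^sup>2 * C = 0} \<le> 2"
proof (cases "\<exists>s. A + s * B + s\<^sup>2 * C = 0")
  case True
  then obtain s where s: "A + s * B + s\<^sup>2 * C = 0" by blast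
  have "t = s \<or> t = - B / C - s" if "A + t * B + t\<^sup>2 * C = 0" for t
  proof -
    have "(t - s) * (B + C * (t + s)) = (A + t * B + t\<^sup>2 * C) - (A + s * B + s\<^sup>2 * C)"
      by (simp add: algebra_simps power2_eq_square)
    then have "t = s \<or> B + C * (t + s) = 0" using s that by simp
    then show ?thesis
    proof
      assume "B + C * (t + s) = 0"
      then have "t + s = - B / C" using assms by (simp add: field_simps eq_neg_iff_add_eq_0)
      then show ?thesis by (metis add_diff_cancel_right')
    qed simp
  qed
  then have "card {t. A + t * B + t\<^sup>2 * C = 0} \<le> card {s, - B / C - s}"
    by (intro card_mono) auto
  also have "\<dots> \<le> 2" by (simp add: card_insert_if)
  finally show ?thesis .
qed simp

text \<open>In the direction \<open>b\<close> the leading coefficient is \<open>Q b\<close>, so each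
  translate contributes at most two zeros.\<close>

lemma card_zeros_le:
  fixes b :: "'a::{field,finite} ^ 'n"
  assumes Q: "quadratic_map Q" and S: "vec.subspace S" and b: "b \<in> S" "Q b \<noteq> 0"
  shows "CARD('a) * card {v \<in> S. Q v = 0} \<le> 2 * card S"
proof -
  have "CARD('a) * card {v \<in> S. Q v = 0} = (\<Sum>v\<in>S. card {t. Q (v + t *s b) = 0})"
    using sum_card_translates[OF S b(1), of "\<lambda>v. Q v = 0"] by simp
  also have "\<dots> \<le> (\<Sum>v\<in>S. 2)"
    by (rule sum_mono) (simp add: quadratic_map_line[OF Q] card_quadratic_roots_le[OF b(2)])
  finally show ?thesis by simp
qed

text \<open>If every singular vector is in the radical, the zeros form a subspace too large to be proper.
  Otherwise the hyperplane is the polar of a singular vector a outside the radical: counting along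
  translates by a leaves more than \<open>2 q\<^sup>2\<close> zeros in it, too many for a nonzero quadratic map.\<close>

lemma null_hyperplane:
  fixes h :: "'a::{field,finite} ^ 4 \<Rightarrow> 'a"
  assumes h: "quadratic_map h" and b: "h b \<noteq> 0"
    and many: "CARD('a) ^ 3 + CARD('a)\<^sup>2 < card {v. h v = 0}"
  obtains l w where "linear_form l" "l w \<noteq> 0" "\<And>v. l v = 0 \<Longrightarrow> h v = 0"
proof -
  let ?q = "CARD('a)"
  have q: "?q > 0" by simp
  have "\<exists>a w. h a = 0 \<and> polar h a w \<noteq> 0"
  proof (rule ccontr)
    assume "\<not> ?thesis"
    then have rad: "polar h a w = 0" if "h a = 0" for a w using that by blast
    define S where "S = {v. h v = 0}"
    have add: "h (u + v) = h u" if "h v = 0" for u v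
      using rad[OF that, of u] that by (simp add: polar_def add.commute)
    \<comment> \<open>If two sums with different \<open>t\<close> agreed, a nonzero multiple of
      \<open>b\<close> would be singular. The injection bounds \<open>S\<close> by
      \<open>q^3\<close>, below the assumed number of zeros.\<close>
    have "inj_on (\<lambda>(t, k). t *s b + k) (UNIV \<times> S)"
    proof (clarsimp simp: inj_on_def S_def)
      fix t k t' k' assume k: "h k = 0" "h k' = 0" and eq: "t *s b + k = t' *s b + k'"
      have "h (- k) = 0" using quadratic_map_scale[OF h, of "-1" k] k by (simp add: vector_smult_lneg)
      then have "h ((t - t') *s b) = 0"
        using add[of "- k" "k'"] k eq
        by (metis (no_types, lifting) add_diff_cancel_left' add_diff_eq diff_diff_eq2
            diff_conv_add_uminus vector_sub_rdistrib)
      then have "t = t'" using quadratic_map_scale[OF h, of "t - t'" b] b by simp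
      then show "t = t' \<and> k = k'" using eq by simp
    qed
    then have "card ((UNIV :: 'a set) \<times> S) \<le> card (UNIV :: ('a ^ 4) set)"
      by (rule card_inj_on_le) auto
    then have "?q * card S \<le> ?q * ?q ^ 3"
      by (simp add: card_cartesian_product power_Suc[symmetric] del: power_Suc)
    then show False using many by (simp add: S_def)
  qed
  then obtain a w where a: "h a = 0" and w: "polar h a w \<noteq> 0" by blast
  note l = linear_form_polar[OF h, of a]
  have K: "?q * card {v. polar h a v = 0} = ?q * ?q ^ 3"
    using card_kernel[OF vec.subspace_UNIV l _ w] by (simp add: power_Suc[symmetric] del: power_Suc)
  then have K: "card {v. polar h a v = 0} = ?q ^ 3" using q by simp
  have "h v = 0" if v: "polar h a v = 0" for v
  proof (rule ccontr)
    assume "h v \<noteq> 0"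
    then have "?q * card {v. polar h a v = 0 \<and> h v = 0} \<le> 2 * ?q ^ 3"
      using card_zeros_le[OF h subspace_kernel[OF vec.subspace_UNIV l], of v] v K by simp
    \<comment> \<open>With at most \<open>2 q^2\<close> zeros in the hyperplane, this identity
      allows at most \<open>q^3 + q^2\<close> zeros in all, contrary to \<open>many\<close>.\<close>
    moreover have "?q * card {v. h v = 0} + ?q ^ 3 = ?q ^ 4 + ?q * card {v. polar h a v = 0 \<and> h v = 0}"
      using singular_vector_count[OF h vec.subspace_UNIV _ a _ w] K by simp
    moreover have "?q * (?q ^ 3 + ?q\<^sup>2) < ?q * card {v. h v = 0}"
      using many q by simp
    ultimately show False by (simp add: algebra_simps power_Suc[symmetric] eval_nat_numeral)
  qed
  with l w that show thesis by blast
qed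

text \<open>Division by \<open>l\<close> without coordinates: write \<open>v = k + s *s w\<close>
  with \<open>l k = 0\<close>. As \<open>h k = 0\<close>, expanding \<open>h\<close> in the
  direction \<open>w\<close> leaves a multiple of \<open>s\<close>, hence of \<open>l v\<close>,
  with cofactor \<open>?m v\<close>.\<close>

lemma quadratic_map_factor:
  fixes h :: "'a::field ^ 'n \<Rightarrow> 'a"
  assumes h: "quadratic_map h" and l: "linear_form l" and w: "l w \<noteq> 0"
    and null: "\<And>v. l v = 0 \<Longrightarrow> h v = 0"
  obtains m where "linear_form m" "\<And>v. h v = l v * m v"
proof
  let ?m = "\<lambda>v. (1 / l w) * polar h v w + (- h w / (l w)\<^sup>2) * l v"
  show "linear_form ?m"
    by (rule linear_form_comb[OF linear_form_polar_left[OF h] l])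
  fix v
  define s where "s = l v / l w"
  have lv: "l v = s * l w" using w by (simp add: s_def)
  define k where "k = v - s *s w"
  have "h k = 0" by (rule null) (simp add: k_def linear_form_simps[OF l] lv)
  have polar: "polar h k w = polar h v w - s * (2 * h w)"
    using linear_form_simps[OF linear_form_polar_left[OF h]] by (simp add: k_def polar_self[OF h])
  have "h v = s * polar h k w + s\<^sup>2 * h w"
    using quadratic_map_line[OF h, of k s w] \<open>h k = 0\<close> by (simp add: k_def)
  then have "h v = s * polar h v w - s\<^sup>2 * h w"
    unfolding polar by (simp add: algebra_simps power2_eq_square)
  also have "\<dots> = l v * ?m v"
    using w unfolding lv by (simp add: field_simps power2_eq_square)
  finally show "h v = l v * ?m v" .
qed

subsection \<open>Elliptic forms\<close>

lemma card_scalar_multiples: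
  fixes a :: "'a::{field,finite} ^ 'n"
  assumes "a \<noteq> 0"
  shows "card (range (\<lambda>c. c *s a)) = CARD('a)"
  using assms by (intro card_image) (simp add: inj_on_def)

lemma card_field_gt_1: "1 < CARD('a::{field,finite})"
proof -
  have "card {0, 1 :: 'a} \<le> CARD('a)" by (intro card_mono) auto
  then show ?thesis by simp
qed

text \<open>\<open>nonsingular\<close> keeps nonzero singular vectors out of the radical. In
  \<open>card_zeros\<close>, the \<open>q^2 + 1\<close> points give
  \<open>(q - 1) (q^2 + 1) + 1 = q^3 - q^2 + q\<close> vectors; \<open>q^2\<close> is moved to the
  left to avoid truncated subtraction.\<close>

locale elliptic_form =
  fixes Q :: "'a::{field,finite} ^ 4 \<Rightarrow> 'a"
  assumes quadratic: "quadratic_map Q"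
    and nonsingular: "a \<noteq> 0 \<Longrightarrow> Q a = 0 \<Longrightarrow> \<exists>w. polar Q a w \<noteq> 0"
    and card_zeros: "card {v. Q v = 0} + CARD('a)\<^sup>2 = CARD('a) ^ 3 + CARD('a)"
begin

lemma card_hyperplane:
  fixes l :: "'a ^ 4 \<Rightarrow> 'a"
  assumes "linear_form l" "l w \<noteq> 0"
  shows "card {v. l v = 0} = CARD('a) ^ 3"
proof -
  have "CARD('a) * card {v. l v = 0} = CARD('a) * CARD('a) ^ 3"
    using card_kernel[OF vec.subspace_UNIV assms(1) _ assms(2)] by (simp add: power_Suc[symmetric] del: power_Suc)
  then show ?thesis by simp
qed

text \<open>\<open>singular_vector_count\<close> on the whole space leaves exactly \<open>q\<close>
  such zeros, and the multiples of \<open>a\<close> already number \<open>q\<close>. Geometrically,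
  a tangent plane meets the quadric only at its point of contact.\<close>

lemma singular_perp:
  assumes a: "a \<noteq> 0" "Q a = 0"
  shows "{v. polar Q a v = 0 \<and> Q v = 0} = range (\<lambda>c. c *s a)"
proof -
  let ?R = "{v. polar Q a v = 0 \<and> Q v = 0}"
  obtain w where w: "polar Q a w \<noteq> 0" using nonsingular[OF a] by blast
  have "CARD('a) * card {v. Q v = 0} + CARD('a) ^ 3 = CARD('a) ^ 4 + CARD('a) * card ?R"
    using singular_vector_count[OF quadratic vec.subspace_UNIV _ a(2) _ w]
      card_hyperplane[OF linear_form_polar[OF quadratic] w] by simp
  moreover have "CARD('a) * card {v. Q v = 0} + CARD('a) ^ 3 = CARD('a) ^ 4 + CARD('a) * CARD('a)"
    using arg_cong[OF card_zeros, of "\<lambda>n. CARD('a) * n"] by (simp add: algebra_simps eval_nat_numeral)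
  ultimately have "card ?R = CARD('a)" by simp
  moreover have "range (\<lambda>c. c *s a) \<subseteq> ?R"
    using a by (auto simp: linear_form_scale[OF linear_form_polar[OF quadratic]] polar_self[OF quadratic]
        quadratic_map_scale[OF quadratic])
  ultimately show ?thesis
    using card_subset_eq[of ?R "range (\<lambda>c. c *s a)"] card_scalar_multiples[OF a(1)] by simp
qed

text \<open>The plane passes through \<open>a\<close> and is not tangent there. Counting inside it
  along \<open>a\<close>, with \<open>singular_perp\<close> for the zeros polar to \<open>a\<close>,
  gives \<open>q^2\<close> vectors, that is, \<open>q + 1\<close> points.\<close>

lemma card_secant_plane:
  assumes l: "linear_form l" and a: "Q a = 0" "l a = 0" and w: "l w = 0" "polar Q a w \<noteq> 0"
    and l0: "l u \<noteq> 0"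
  shows "card {v. l v = 0 \<and> Q v = 0} = CARD('a)\<^sup>2"
proof -
  let ?S = "{v. l v = 0}"
  have "a \<noteq> 0" using w(2) by (auto simp: linear_form_zero[OF linear_form_polar_left[OF quadratic]])
  have S: "vec.subspace ?S" using subspace_kernel[OF vec.subspace_UNIV l] by simp
  have "CARD('a) * card {v \<in> ?S. polar Q a v = 0} = CARD('a) * CARD('a)\<^sup>2"
    using card_kernel[OF S linear_form_polar[OF quadratic], of w a] w card_hyperplane[OF l l0]
    by (simp add: eval_nat_numeral)
  then have K: "card {v \<in> ?S. polar Q a v = 0} = CARD('a)\<^sup>2" by simp
  have "{v \<in> ?S. polar Q a v = 0 \<and> Q v = 0} = range (\<lambda>c. c *s a)"
    using singular_perp[OF \<open>a \<noteq> 0\<close> a(1)] a(2) by (auto simp: linear_form_scale[OF l])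
  then have "CARD('a) * card {v \<in> ?S. Q v = 0} + CARD('a)\<^sup>2 = CARD('a) ^ 3 + CARD('a) * CARD('a)"
    using singular_vector_count[OF quadratic S _ a(1) _ w(2)] a w K card_hyperplane[OF l l0]
      card_scalar_multiples[OF \<open>a \<noteq> 0\<close>] by simp
  then have "CARD('a) * card {v \<in> ?S. Q v = 0} = CARD('a) * CARD('a)\<^sup>2"
    by (simp add: eval_nat_numeral)
  then show ?thesis by simp
qed

text \<open>A plane is secant with \<open>q^2\<close> singular vectors, tangent with
  \<open>q\<close>, or contains only the singular vector 0.\<close>

lemma card_plane_le:
  assumes l: "linear_form l" "l u \<noteq> 0"
  shows "card {v. l v = 0 \<and> Q v = 0} \<le> CARD('a)\<^sup>2"
proof (cases "\<exists>a. a \<noteq> 0 \<and> l a = 0 \<and> Q a = 0")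
  case True
  then obtain a where a: "a \<noteq> 0" "l a = 0" "Q a = 0" by blast
  show ?thesis
  proof (cases "\<exists>w. l w = 0 \<and> polar Q a w \<noteq> 0")
    case True
    then show ?thesis using card_secant_plane[OF l(1) a(3,2) _ _ l(2)] by fastforce
  next
    case False
    then have "{v. l v = 0 \<and> Q v = 0} \<subseteq> range (\<lambda>c. c *s a)"
      using singular_perp[OF a(1,3)] by blast
    then have "card {v. l v = 0 \<and> Q v = 0} \<le> card (range (\<lambda>c. c *s a))"
      by (rule card_mono[rotated]) simp
    also have "\<dots> \<le> CARD('a)\<^sup>2" unfolding card_scalar_multiples[OF a(1)] by (simp add: power2_eq_square)
    finally show ?thesis .
  qed
next
  case False
  then have "card {v. l v = 0 \<and> Q v = 0} \<le> card {0 :: 'a ^ 4}" by (intro card_mono) auto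
  also have "\<dots> \<le> CARD('a)\<^sup>2" by (simp add: Suc_le_eq)
  finally show ?thesis .
qed

lemma card_plane_pair:
  assumes "linear_form l" "linear_form m"
  shows "card {v. Q v = 0 \<and> l v * m v = 0} + card {v. Q v = 0 \<and> l v = 0 \<and> m v = 0}
    = card {v. l v = 0 \<and> Q v = 0} + card {v. m v = 0 \<and> Q v = 0}"
proof -
  have "{v. Q v = 0 \<and> l v * m v = 0} = {v. l v = 0 \<and> Q v = 0} \<union> {v. m v = 0 \<and> Q v = 0}"
    "{v. Q v = 0 \<and> l v = 0 \<and> m v = 0} = {v. l v = 0 \<and> Q v = 0} \<inter> {v. m v = 0 \<and> Q v = 0}" by auto
  then show ?thesis using card_Un_Int[of "{v. l v = 0 \<and> Q v = 0}" "{v. m v = 0 \<and> Q v = 0}"] by simp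
qed

text \<open>If the intersection were larger, averaging over the pencil spanned by the two forms would
  give a member with more zeros than a hyperbolic quadric, that is, a pair of planes.\<close>

lemma card_common_zeros_less:
  assumes g: "quadratic_map g" and u: "Q u = 0" "g u \<noteq> 0"
  shows "card {v. Q v = 0 \<and> g v = 0} < 2 * CARD('a)\<^sup>2"
proof (rule ccontr)
  let ?N = "card {v. Q v = 0 \<and> g v = 0}"
  assume "\<not> ?N < 2 * CARD('a)\<^sup>2"
  then have N: "2 * CARD('a)\<^sup>2 \<le> ?N" by simp
  \<comment> \<open>A vector with \<open>Q v\<close> nonzero is a zero of exactly one member of the
    pencil, a common zero lies on all \<open>q\<close> members, and any other zero of
    \<open>Q\<close> on none.\<close>
  have "card {c. g v + c * Q v = 0} = (if v \<in> {v. Q v \<noteq> 0} then 1 else 0) +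
      (if v \<in> {v. Q v = 0 \<and> g v = 0} then CARD('a) else 0)" for v
  proof (cases "Q v = 0")
    case False
    then have "{c. g v + c * Q v = 0} = {- g v / Q v}"
      by (auto simp: field_simps add_eq_0_iff)
    with False show ?thesis by simp
  qed simp
  then have "(\<Sum>v\<in>UNIV. card {c. g v + c * Q v = 0}) = card {v. Q v \<noteq> 0} + CARD('a) * ?N"
    by (simp add: sum.distrib sum.If_cases del: mem_Collect_eq)
  moreover have "(\<Sum>c\<in>UNIV. card {v. g v + c * Q v = 0}) = (\<Sum>v\<in>UNIV. card {c. g v + c * Q v = 0})"
    using sum_multicount_gen[of UNIV UNIV "\<lambda>c v. g v + c * Q v = 0"] by simp
  moreover have "card {v. Q v \<noteq> 0} + card {v. Q v = 0} = CARD('a) ^ 4"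
  proof -
    have "{v. Q v \<noteq> 0} = UNIV - {v. Q v = 0}" by auto
    then show ?thesis using card_Diff_subset[of "{v. Q v = 0}" UNIV] card_mono[of UNIV "{v. Q v = 0}"] by simp
  qed
  ultimately have sum: "(\<Sum>c\<in>UNIV. card {v. g v + c * Q v = 0}) + (CARD('a) ^ 3 + CARD('a)) = CARD('a) ^ 4 + CARD('a)\<^sup>2 + CARD('a) * ?N"
    using card_zeros by linarith
  \<comment> \<open>By \<open>N\<close> the sum is at least \<open>q^4 + q^3 + q^2 - q\<close>, more
    than \<open>q\<close> times the threshold of \<open>null_hyperplane\<close>.\<close>
  have "\<exists>c. CARD('a) ^ 3 + CARD('a)\<^sup>2 < card {v. g v + c * Q v = 0}"
  proof (rule ccontr)
    assume "\<not> ?thesis"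
    then have "(\<Sum>c\<in>UNIV. card {v. g v + c * Q v = 0}) \<le> (\<Sum>c\<in>(UNIV :: 'a set). CARD('a) ^ 3 + CARD('a)\<^sup>2)"
      by (intro sum_mono) (simp add: not_less)
    then have "CARD('a) ^ 4 + CARD('a)\<^sup>2 + CARD('a) * ?N \<le> CARD('a) * (CARD('a) ^ 3 + CARD('a)\<^sup>2) + (CARD('a) ^ 3 + CARD('a))"
      using sum by simp
    moreover have "CARD('a) * (2 * CARD('a)\<^sup>2) \<le> CARD('a) * ?N" using N by simp
    moreover have "CARD('a) * (CARD('a) ^ 3 + CARD('a)\<^sup>2) = CARD('a) ^ 4 + CARD('a) ^ 3"
      "CARD('a) * (2 * CARD('a)\<^sup>2) = 2 * CARD('a) ^ 3"
      by (simp_all add: algebra_simps eval_nat_numeral)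
    ultimately have "CARD('a)\<^sup>2 \<le> CARD('a)" by linarith
    then show False using card_field_gt_1[where 'a = 'a] by (simp add: power2_eq_square)
  qed
  then obtain c where c: "CARD('a) ^ 3 + CARD('a)\<^sup>2 < card {v. g v + c * Q v = 0}" by blast
  define h where "h v = g v + c * Q v" for v
  have h: "quadratic_map h"
    unfolding h_def by (rule quadratic_map_comb[OF g quadratic])
  \<comment> \<open>As \<open>Q u = 0\<close>, every member of the pencil takes the value
    \<open>g u\<close> at \<open>u\<close>; so \<open>h\<close>, and later its factor
    \<open>m\<close>, does not vanish identically.\<close>
  have hu: "h u \<noteq> 0" using u by (simp add: h_def)
  have "CARD('a) ^ 3 + CARD('a)\<^sup>2 < card {v. h v = 0}" using c by (simp add: h_def)
  then obtain l w where l: "linear_form l" "l w \<noteq> 0" and null: "\<And>v. l v = 0 \<Longrightarrow> h v = 0"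
    by (rule null_hyperplane[OF h hu]) (rule that)
  obtain m where m: "linear_form m" and hm: "\<And>v. h v = l v * m v"
    by (rule quadratic_map_factor[OF h l null], assumption) (rule that)
  have "m u \<noteq> 0" using hu by (simp add: hm)
  \<comment> \<open>The zero vector is counted on both planes, so their union has at most
    \<open>2 q^2 - 1\<close> singular vectors, one fewer than \<open>N\<close> demands.\<close>
  have "0 \<in> {v. Q v = 0 \<and> l v = 0 \<and> m v = 0}"
    using quadratic l m by (simp add: quadratic_map_zero linear_form_zero)
  then have "card {v. Q v = 0 \<and> l v = 0 \<and> m v = 0} > 0"
    by (intro card_gt_0_iff[THEN iffD2]) auto
  moreover have "{v. Q v = 0 \<and> g v = 0} = {v. Q v = 0 \<and> l v * m v = 0}"
    by (auto simp: hm[symmetric] h_def)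
  ultimately show False
    using card_plane_pair[OF l(1) m] card_plane_le[OF l] card_plane_le[OF m \<open>m u \<noteq> 0\<close>] N by simp
qed

text \<open>This supplies a secant line. There are more than \<open>q\<close> singular vectors, so
  some \<open>b\<close> is not a multiple of \<open>a\<close>, and \<open>singular_perp\<close>
  makes \<open>polar Q a b\<close> nonzero.\<close>

lemma singular_pair:
  obtains a b where "Q a = 0" "Q b = 0" "a \<noteq> 0" "b \<noteq> 0" "polar Q a b \<noteq> 0"
proof -
  have "CARD('a) < card {v. Q v = 0}"
  proof -
    have "CARD('a)\<^sup>2 < CARD('a) ^ 3"
      using card_field_gt_1[where 'a = 'a] by (intro power_strict_increasing) auto
    then show ?thesis using card_zeros by linarith
  qed
  then have not_sub: "\<exists>v. Q v = 0 \<and> v \<notin> S" if "card S \<le> CARD('a)" for S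
    using that card_mono[of S "{v. Q v = 0}"] by (auto simp: subset_iff)
  obtain a where a: "Q a = 0" "a \<noteq> 0"
    using not_sub[of "{0}"] card_field_gt_1[where 'a = 'a] by auto
  have "card (range (\<lambda>c. c *s a)) \<le> CARD('a)"
    using card_scalar_multiples[OF a(2)] by simp
  then obtain b where b: "Q b = 0" "b \<notin> range (\<lambda>c. c *s a)"
    using not_sub by blast
  then have "polar Q a b \<noteq> 0" using singular_perp[OF a(2,1)] by blast
  moreover have "b \<noteq> 0" using b(2) rangeI[of "\<lambda>c. c *s a" 0] by auto
  ultimately show thesis using a b that by blast
qed

end

subsection \<open>Pairs of planes attaining the extremal intersections\<close>

text \<open>Forms are represented by coefficient vectors through the dot product. Those vanishing at
  \<open>a\<close> and \<open>b\<close> make up a space \<open>T\<close> of at least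
  \<open>q^2\<close> elements, which contains two independent vectors; \<open>w\<close> and
  \<open>w'\<close> witness the independence.\<close>

lemma linear_forms_vanishing:
  fixes a b :: "'a::{field,finite} ^ 4"
  assumes "a \<noteq> 0"
  obtains l m w w' where "linear_form l" "linear_form m" "l a = 0" "l b = 0" "m a = 0" "m b = 0"
    "l w \<noteq> 0" "l w' = 0" "m w' \<noteq> 0"
proof -
  define dot :: "'a ^ 4 \<Rightarrow> 'a ^ 4 \<Rightarrow> 'a" where "dot c v = (\<Sum>i\<in>UNIV. c $ i * v $ i)" for c v
  have dot: "linear_form (dot c)" for c
    by (simp add: linear_form_def dot_def algebra_simps sum.distrib sum_distrib_left)
  have dot_commute: "dot c v = dot v c" for c v
    by (simp add: dot_def mult.commute)
  have dot_nonzero: "\<exists>v. dot c v \<noteq> 0" if c: "c \<noteq> 0" for c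
  proof -
    obtain i where "c $ i \<noteq> 0" using c by (auto simp: vec_eq_iff)
    moreover have "dot c (axis i 1) = c $ i" by (simp add: dot_def axis_def if_distrib cong: if_cong)
    ultimately show ?thesis by metis
  qed
  define S where "S = {c. dot a c = 0}"
  define T where "T = {c \<in> S. dot b c = 0}"
  obtain c where "dot a c \<noteq> 0" using dot_nonzero[OF assms] by blast
  then have "CARD('a) * card S = CARD('a) * CARD('a) ^ 3"
    using card_kernel[OF vec.subspace_UNIV dot, of c a] by (simp add: S_def power_Suc[symmetric] del: power_Suc)
  then have S: "card S = CARD('a) ^ 3" by simp
  have "vec.subspace S" using subspace_kernel[OF vec.subspace_UNIV dot] by (simp add: S_def)
  \<comment> \<open>Only an inequality, since \<open>b\<close> may be a multiple of
    \<open>a\<close>.\<close>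
  have "CARD('a) * CARD('a)\<^sup>2 \<le> CARD('a) * card T"
  proof (cases "\<exists>c\<in>S. dot b c \<noteq> 0")
    case True
    then show ?thesis
      using card_kernel[OF \<open>vec.subspace S\<close> dot, of _ b] S by (auto simp: T_def eval_nat_numeral)
  next
    case False
    then have "T = S" by (auto simp: T_def)
    then show ?thesis using S by (simp add: eval_nat_numeral)
  qed
  then have "CARD('a)\<^sup>2 \<le> card T" by simp
  moreover have "CARD('a) < CARD('a)\<^sup>2"
    using card_field_gt_1[where 'a = 'a] by (simp add: power2_eq_square)
  ultimately have "CARD('a) < card T" by simp
  then have ex: "\<exists>c. c \<in> T \<and> c \<notin> U" if "card U \<le> CARD('a)" for U
    using that card_mono[of U T] by (auto simp: subset_iff)
  obtain c where c: "c \<in> T" "c \<noteq> 0"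
    using ex[of "{0}"] card_field_gt_1[where 'a = 'a] by auto
  have "card (range (\<lambda>t. t *s c)) \<le> CARD('a)"
    using card_scalar_multiples[OF c(2)] by simp
  then obtain d where d: "d \<in> T" "d \<notin> range (\<lambda>t. t *s c)"
    using ex by blast
  obtain w where w: "dot c w \<noteq> 0" using dot_nonzero[OF c(2)] by blast
  have "\<exists>w'. dot c w' = 0 \<and> dot d w' \<noteq> 0"
  proof (rule ccontr)
    assume no: "\<not> ?thesis"
    define t where "t = dot d w / dot c w"
    have "dot (d - t *s c) v = 0" for v
    proof -
      define s where "s = dot c v / dot c w"
      have "dot c (v - s *s w) = 0" using w by (simp add: linear_form_simps[OF dot] s_def)
      then have "dot d (v - s *s w) = 0" using no by blast
      then have "dot d v = t * dot c v"
        using w by (simp add: linear_form_simps[OF dot] s_def t_def)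
      then show ?thesis
        by (simp add: dot_commute[of _ v] linear_form_simps[OF dot])
    qed
    then have "d - t *s c = 0" using dot_nonzero by blast
    then show False using d(2) by auto
  qed
  then obtain w' where w': "dot c w' = 0" "dot d w' \<noteq> 0" by blast
  show thesis
    using that[of "dot c" "dot d" w w'] dot w w' c(1) d(1) by (simp add: S_def T_def dot_commute)
qed

context elliptic_form
begin

lemma quadratic_on_span:
  assumes "Q a = 0" "Q b = 0"
  shows "Q (x *s a + y *s b) = x * y * polar Q a b"
  using quadratic_map_line[OF quadratic, of "x *s a" y b] assms
  by (simp add: quadratic_map_scale[OF quadratic] linear_form_scale[OF linear_form_polar_left[OF quadratic]])

text \<open>Pairing with \<open>b\<close> kills the right side because
  \<open>polar Q b b = 2 * Q b = 0\<close>; pairing with \<open>a\<close> kills the left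
  side.\<close>

lemma singular_independent:
  assumes "Q a = 0" "Q b = 0" "polar Q a b \<noteq> 0" "x *s a = y *s b"
  shows "x = 0 \<and> y = 0"
proof -
  have "polar Q (x *s a) b = y * polar Q b b" "polar Q a (x *s a) = y * polar Q a b"
    using assms(4) by (simp_all add: linear_form_scale[OF linear_form_polar_left[OF quadratic]]
        linear_form_scale[OF linear_form_polar[OF quadratic]])
  then show ?thesis
    using assms(1-3) by (auto simp: polar_self[OF quadratic] linear_form_zero[OF linear_form_polar[OF quadratic]]
        linear_form_scale[OF linear_form_polar_left[OF quadratic]]
        linear_form_scale[OF linear_form_polar[OF quadratic]])
qed

lemma card_two_singular_lines:
  assumes "Q a = 0" "Q b = 0" "polar Q a b \<noteq> 0" "a \<noteq> 0" "b \<noteq> 0"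
  shows "card (range (\<lambda>c. c *s a) \<union> range (\<lambda>c. c *s b)) + 1 = 2 * CARD('a)"
proof -
  have "range (\<lambda>c. c *s a) \<inter> range (\<lambda>c. c *s b) = {0}"
    using singular_independent[OF assms(1-3)] rangeI[of "\<lambda>c. c *s a" 0] rangeI[of "\<lambda>c. c *s b" 0]
    by fastforce
  then show ?thesis
    using card_Un_Int[of "range (\<lambda>c. c *s a)" "range (\<lambda>c. c *s b)"]
      card_scalar_multiples[OF assms(4)] card_scalar_multiples[OF assms(5)] by simp
qed

text \<open>The planes meet in the secant through \<open>a\<close> and \<open>b\<close>, on which
  \<open>Q\<close> is a multiple of the product of two coordinates. Hence \<open>2 q - 1\<close>
  singular vectors are shared, and the pair has \<open>2 q\<close> points of the quadric.\<close>

lemma secant_plane_pair_secant_axis: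
  obtains l m where "linear_form l" "linear_form m"
    "card {v. Q v = 0 \<and> l v * m v = 0} + 2 * CARD('a) = 2 * CARD('a)\<^sup>2 + 1"
proof -
  obtain a b where ab: "Q a = 0" "Q b = 0" "a \<noteq> 0" "b \<noteq> 0" "polar Q a b \<noteq> 0"
    by (rule singular_pair) (rule that)
  obtain l m w w' where l: "linear_form l" "l a = 0" "l b = 0" "l w \<noteq> 0"
    and m: "linear_form m" "m a = 0" "m b = 0" and w': "l w' = 0" "m w' \<noteq> 0"
    by (rule linear_forms_vanishing[OF ab(3), of b]) (rule that)
  let ?W = "{v \<in> {v. l v = 0}. m v = 0}"
  have S: "vec.subspace {v. l v = 0}" using subspace_kernel[OF vec.subspace_UNIV l(1)] by simp
  have "CARD('a) * card ?W = CARD('a) * CARD('a)\<^sup>2"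
    using card_kernel[OF S m(1), of w'] w' card_hyperplane[OF l(1,4)] by (simp add: eval_nat_numeral)
  then have W: "card ?W = CARD('a)\<^sup>2" by simp
  let ?f = "\<lambda>(x, y). x *s a + y *s b"
  have inj: "inj ?f"
  proof (clarsimp simp: inj_on_def)
    fix x y x' y' assume eq: "x *s a + y *s b = x' *s a + y' *s b"
    have "(x - x') *s a = (y' - y) *s b"
      using eq by (simp add: vector_sub_rdistrib algebra_simps)
    from singular_independent[OF ab(1,2,5) this] show "x = x' \<and> y = y'" by simp
  qed
  have "?W = range ?f"
  proof (rule card_subset_eq[symmetric])
    show "range ?f \<subseteq> ?W"
      using l m by (auto simp: linear_form_simps)
    show "card (range ?f) = card ?W"
      unfolding card_image[OF inj] W by (simp add: power2_eq_square)
  qed simp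
  then have "{v. Q v = 0 \<and> l v = 0 \<and> m v = 0} = {v \<in> range ?f. Q v = 0}" by auto
  also have "\<dots> = range (\<lambda>c. c *s a) \<union> range (\<lambda>c. c *s b)"
  proof (intro equalityI subsetI)
    fix v assume "v \<in> {v \<in> range ?f. Q v = 0}"
    then obtain x y where v: "v = x *s a + y *s b" "Q v = 0" by auto
    then have "x = 0 \<or> y = 0" using quadratic_on_span[OF ab(1,2), of x y] ab(5) by simp
    then show "v \<in> range (\<lambda>c. c *s a) \<union> range (\<lambda>c. c *s b)" using v by auto
  next
    fix v assume "v \<in> range (\<lambda>c. c *s a) \<union> range (\<lambda>c. c *s b)"
    then obtain x y where "v = x *s a + y *s b" "x = 0 \<or> y = 0"
      by (metis (no_types, lifting) Un_iff add_0 add.right_neutral imageE vector_smult_lzero)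
    then show "v \<in> {v \<in> range ?f. Q v = 0}"
      using quadratic_on_span[OF ab(1,2), of x y] by auto
  qed
  finally have "card {v. Q v = 0 \<and> l v = 0 \<and> m v = 0} + 1 = 2 * CARD('a)"
    using card_two_singular_lines[OF ab(1,2,5,3,4)] by simp
  then have "card {v. Q v = 0 \<and> l v * m v = 0} + 2 * CARD('a) = 2 * CARD('a)\<^sup>2 + 1"
    using card_plane_pair[OF l(1) m(1)] card_secant_plane[OF l(1) ab(1) l(2,3) ab(5) l(4)]
      card_secant_plane[OF m(1) ab(1) m(2,3) ab(5) w'(2)] by simp
  with l(1) m(1) that show thesis by blast
qed

text \<open>One plane contains the secant through \<open>a\<close> and \<open>b\<close>; the other
  is chosen in the pencil it spans with the tangent plane at \<open>b\<close>. Their axis is thus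
  tangent at \<open>b\<close> and shares \<open>q\<close> singular vectors, which leaves
  \<open>2 q + 1\<close> points.\<close>

lemma secant_plane_pair_tangent_axis:
  obtains l m where "linear_form l" "linear_form m"
    "card {v. Q v = 0 \<and> l v * m v = 0} + CARD('a) = 2 * CARD('a)\<^sup>2"
proof -
  obtain a b where ab: "Q a = 0" "Q b = 0" "a \<noteq> 0" "b \<noteq> 0" "polar Q a b \<noteq> 0"
    by (rule singular_pair) (rule that)
  obtain l w where l: "linear_form l" "l a = 0" "l b = 0" "l w \<noteq> 0"
    by (rule linear_forms_vanishing[OF ab(3), of b]) (rule that)
  let ?x = "polar Q b"
  have x: "linear_form ?x" by (rule linear_form_polar[OF quadratic])
  define m where "m v = l v - ?x v" for v
  have m: "linear_form m" unfolding m_def by (rule linear_form_subtract[OF l(1) x])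
  have xa: "?x a \<noteq> 0" using ab(5) by (simp add: polar_commute)
  then have ma: "m a \<noteq> 0" using l by (simp add: m_def)
  have xb: "?x b = 0" using ab(2) by (simp add: polar_self[OF quadratic])
  \<comment> \<open>The multiple of \<open>a\<close> is chosen to make \<open>m u = 0\<close>; then
    \<open>?x u = l w\<close>, so the plane of \<open>m\<close> is not the tangent plane at
    \<open>b\<close>.\<close>
  define u where "u = w + ((l w - ?x w) / ?x a) *s a"
  have u: "m u = 0" "?x u \<noteq> 0"
    using l xa by (simp_all add: u_def m_def linear_form_simps[OF l(1)] linear_form_simps[OF x])
  have "{v. Q v = 0 \<and> l v = 0 \<and> m v = 0} = range (\<lambda>c. c *s b)"
    using singular_perp[OF ab(4,2)] l by (auto simp: m_def linear_form_simps[OF l(1)])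
  then have "card {v. Q v = 0 \<and> l v = 0 \<and> m v = 0} = CARD('a)"
    using card_scalar_multiples[OF ab(4)] by simp
  moreover have "card {v. l v = 0 \<and> Q v = 0} = CARD('a)\<^sup>2"
    by (rule card_secant_plane[OF l(1) ab(1) l(2,3) ab(5) l(4)])
  moreover have "card {v. m v = 0 \<and> Q v = 0} = CARD('a)\<^sup>2"
    using l xb by (intro card_secant_plane[OF m ab(2) _ u ma]) (simp add: m_def)
  ultimately have "card {v. Q v = 0 \<and> l v * m v = 0} + CARD('a) = 2 * CARD('a)\<^sup>2"
    using card_plane_pair[OF l(1) m] by simp
  with l(1) m that show thesis by blast
qed

text \<open>The planes through the line polar to a secant: apart from the two tangent planes, each meets
  the quadric in at most \<open>q + 1\<close> points, and together they must cover the remaining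
  \<open>(q - 1) (q + 1)\<close> points.\<close>

lemma card_external_pencil_plane:
  assumes ab: "Q a = 0" "Q b = 0" "a \<noteq> 0" "b \<noteq> 0" "polar Q a b \<noteq> 0" and t: "t \<noteq> 0"
  shows "card {v. polar Q b v - t * polar Q a v = 0 \<and> Q v = 0} = CARD('a)\<^sup>2"
proof -
  let ?x = "polar Q b" and ?y = "polar Q a"
  have x: "linear_form ?x" and y: "linear_form ?y" by (rule linear_form_polar[OF quadratic])+
  have xy: "linear_form (\<lambda>v. ?x v - s * ?y v)" for s
    using linear_form_comb[OF x y, of 1 "- s"] by simp
  have xa: "?x a \<noteq> 0" using ab(5) by (simp add: polar_commute)
  have self: "?x b = 0" "?y a = 0" using ab(1,2) by (simp_all add: polar_self[OF quadratic])
  let ?D = "range (\<lambda>c. c *s a) \<union> range (\<lambda>c. c *s b)"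
  have D: "?x v = 0 \<or> ?y v = 0 \<longleftrightarrow> v \<in> ?D" if "Q v = 0" for v
    using singular_perp[OF ab(3,1)] singular_perp[OF ab(4,2)] that by blast
  have D_Q: "Q v = 0" if "v \<in> ?D" for v
    using ab that by (auto simp: quadratic_map_scale[OF quadratic])
  \<comment> \<open>\<open>?D\<close> holds the zeros on the two tangent planes. Any other zero has
    a nonzero ratio \<open>?x v / ?y v\<close>, which places it in exactly one
    \<open>E s\<close>.\<close>
  define E where "E s = {v. Q v = 0 \<and> v \<notin> ?D \<and> ?x v = s * ?y v}" for s
  have plane: "{v. ?x v - s * ?y v = 0 \<and> Q v = 0} = insert 0 (E s)" if s: "s \<noteq> 0" for s
  proof -
    have "v = 0" if v: "v \<in> ?D" "?x v = s * ?y v" for v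
    proof -
      have "?x v = 0" "?y v = 0" using D[OF D_Q[OF v(1)]] v s by auto
      then obtain c d where "v = c *s a" "v = d *s b"
        using D_Q[OF v(1)] singular_perp[OF ab(3,1)] singular_perp[OF ab(4,2)] by blast
      then show ?thesis using singular_independent[OF ab(1,2,5), of c d] by simp
    qed
    then show ?thesis
      by (auto simp: E_def quadratic_map_zero[OF quadratic] linear_form_zero[OF x] linear_form_zero[OF y])
  qed
  have "0 \<in> ?D" using rangeI[of "\<lambda>c. c *s a" 0] by simp
  then have "0 \<notin> E s" for s unfolding E_def by blast
  then have cardE: "card {v. ?x v - s * ?y v = 0 \<and> Q v = 0} = card (E s) + 1" if "s \<noteq> 0" for s
    unfolding plane[OF that] by simp
  have le: "card (E s) \<le> CARD('a)\<^sup>2 - 1" if "s \<in> UNIV - {0}" for s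
    using card_plane_le[OF xy[of s], of a] cardE[of s] that xa self by simp
  have "{v. Q v = 0} = ?D \<union> (\<Union>s\<in>UNIV - {0}. E s)"
  proof (intro equalityI subsetI)
    fix v assume "v \<in> {v. Q v = 0}"
    then show "v \<in> ?D \<union> (\<Union>s\<in>UNIV - {0}. E s)"
      using D[of v] by (auto simp: E_def intro!: bexI[of _ "?x v / ?y v"])
  qed (use D_Q in \<open>auto simp: E_def\<close>)
  then have "card {v. Q v = 0} = card ?D + card (\<Union>s\<in>UNIV - {0}. E s)"
    by (simp only:) (rule card_Un_disjoint; auto simp: E_def)
  also have "card (\<Union>s\<in>UNIV - {0}. E s) = (\<Sum>s\<in>UNIV - {0}. card (E s))"
  proof (rule card_UN_disjoint)
    show "\<forall>s\<in>UNIV - {0}. \<forall>s'\<in>UNIV - {0}. s \<noteq> s' \<longrightarrow> E s \<inter> E s' = {}"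
    proof (intro ballI impI)
      fix s s' :: 'a assume "s \<noteq> s'"
      have "s = s'" if v: "v \<in> E s" "v \<in> E s'" for v
      proof -
        have "?y v \<noteq> 0" "s * ?y v = s' * ?y v" using v D[of v] by (auto simp: E_def)
        then show ?thesis by simp
      qed
      with \<open>s \<noteq> s'\<close> show "E s \<inter> E s' = {}" by blast
    qed
  qed auto
  finally have "(\<Sum>s\<in>UNIV - {0}. card (E s)) + 2 * CARD('a) + CARD('a)\<^sup>2 = CARD('a) ^ 3 + CARD('a) + 1"
    using card_zeros card_two_singular_lines[OF ab(1,2,5,3,4)] by simp
  moreover obtain n where n: "CARD('a) = Suc n" using card_field_gt_1[where 'a = 'a] by (cases "CARD('a)") auto
  ultimately have eq: "(\<Sum>s\<in>UNIV - {0}. card (E s)) = (\<Sum>s\<in>(UNIV - {0 :: 'a}). CARD('a)\<^sup>2 - 1)"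
    by (simp add: card_Diff_singleton eval_nat_numeral algebra_simps)
  \<comment> \<open>The upper bounds add up to exactly the number of zeros outside
    \<open>?D\<close>, so each of them is attained.\<close>
  have "card (E t) = CARD('a)\<^sup>2 - 1"
    by (rule sum_mono_inv[OF eq le]) (use t in auto)
  moreover have "CARD('a)\<^sup>2 > 0" by simp
  ultimately show ?thesis using cardE[OF t] by simp
qed

text \<open>Two planes of the preceding pencil, with parameters 1 and \<open>t\<close>; a second
  nonzero parameter exists because \<open>q\<close> is at least 3. A singular vector on their axis
  is a multiple of both \<open>a\<close> and \<open>b\<close>, hence 0, and the pair has
  \<open>2 q + 2\<close> points.\<close>

lemma secant_plane_pair_external_axis:
  assumes "3 \<le> CARD('a)"
  obtains l m where "linear_form l" "linear_form m"
    "card {v. Q v = 0 \<and> l v * m v = 0} + 1 = 2 * CARD('a)\<^sup>2"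
proof -
  obtain a b where ab: "Q a = 0" "Q b = 0" "a \<noteq> 0" "b \<noteq> 0" "polar Q a b \<noteq> 0"
    by (rule singular_pair) (rule that)
  let ?x = "polar Q b" and ?y = "polar Q a"
  have x: "linear_form ?x" and y: "linear_form ?y" by (rule linear_form_polar[OF quadratic])+
  have xy: "linear_form (\<lambda>v. ?x v - s * ?y v)" for s
    using linear_form_comb[OF x y, of 1 "- s"] by simp
  have "\<not> UNIV \<subseteq> {0, 1 :: 'a}"
    using card_mono[of "{0, 1 :: 'a}" UNIV] assms by auto
  then obtain t :: 'a where t: "t \<noteq> 0" "t \<noteq> 1" by blast
  let ?l = "\<lambda>v. ?x v - 1 * ?y v" and ?m = "\<lambda>v. ?x v - t * ?y v"
  have "v = 0" if v: "Q v = 0" "?l v = 0" "?m v = 0" for v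
  proof -
    have "(1 - t) * ?y v = 0" using v by (simp add: algebra_simps)
    then have "?y v = 0" "?x v = 0" using v t by auto
    then obtain c d where "v = c *s a" "v = d *s b"
      using v(1) singular_perp[OF ab(3,1)] singular_perp[OF ab(4,2)] by blast
    then show ?thesis using singular_independent[OF ab(1,2,5), of c d] by simp
  qed
  then have "{v. Q v = 0 \<and> ?l v = 0 \<and> ?m v = 0} = {0}"
    using quadratic_map_zero[OF quadratic] linear_form_zero[OF x] linear_form_zero[OF y] by auto
  then have "card {v. Q v = 0 \<and> ?l v * ?m v = 0} + 1 = 2 * CARD('a)\<^sup>2"
    using card_plane_pair[OF xy xy, of 1 t]
      card_external_pencil_plane[OF ab, of 1] card_external_pencil_plane[OF ab t(1)] by simp
  with xy that show thesis by blast
qed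

end

subsection \<open>From vectors to points and codewords\<close>

text \<open>A nonzero vector is uniquely a nonzero scalar times a normalised one; the summand 1 is
  the zero vector.\<close>

lemma card_proj3:
  fixes P :: "'a::{field,finite} ^ 4 \<Rightarrow> bool"
  assumes P0: "P 0" and scale: "\<And>c v. c \<noteq> 0 \<Longrightarrow> P (c *s v) \<longleftrightarrow> P v"
  shows "card {v. P v} = (CARD('a) - 1) * card {x \<in> proj3. P x} + 1"
proof -
  let ?X = "{x \<in> proj3. P x}"
  have nz: "x \<noteq> 0" if "x \<in> proj3" for x :: "'a ^ 4"
    using that by (auto simp: proj3_def)
  have "bij_betw (\<lambda>(c, x). c *s x) ((UNIV - {0}) \<times> ?X) ({v. P v} - {0})"
  proof (rule bij_betw_imageI)
    show "inj_on (\<lambda>(c, x). c *s x) ((UNIV - {0}) \<times> ?X)"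
    proof (clarsimp simp: inj_on_def)
      fix c d :: 'a and x y :: "'a ^ 4"
      assume cd: "c \<noteq> 0" "d \<noteq> 0" and "x \<in> proj3" "y \<in> proj3" and eq: "c *s x = d *s y"
      then obtain i j where i: "x $ i = 1" "\<And>k. k < i \<Longrightarrow> x $ k = 0"
        and j: "y $ j = 1" "\<And>k. k < j \<Longrightarrow> y $ k = 0"
        unfolding proj3_def by blast
      have comp: "c * x $ k = d * y $ k" for k
        using arg_cong[OF eq, of "\<lambda>v. v $ k"] by simp
      have "\<not> i < j" using comp[of i] i(1) j(2)[of i] cd by auto
      moreover have "\<not> j < i" using comp[of j] j(1) i(2)[of j] cd by auto
      ultimately have "i = j" by simp
      then have "c = d" using comp[of i] i(1) j(1) by simp
      then show "c = d \<and> x = y" using eq cd by simp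
    qed
    show "(\<lambda>(c, x). c *s x) ` ((UNIV - {0}) \<times> ?X) = {v. P v} - {0}"
    proof (intro equalityI subsetI)
      fix v assume v: "v \<in> {v. P v} - {0}"
      define i where "i = Min {i. v $ i \<noteq> 0}"
      have "{i. v $ i \<noteq> 0} \<noteq> {}" using v by (auto simp: vec_eq_iff)
      then have i: "v $ i \<noteq> 0" using Min_in[of "{i. v $ i \<noteq> 0}"] by (simp add: i_def)
      have "i \<le> j" if "v $ j \<noteq> 0" for j
        unfolding i_def by (rule Min_le) (use that in auto)
      then have less: "v $ j = 0" if "j < i" for j
        using that leD by blast
      let ?x = "inverse (v $ i) *s v"
      have "?x \<in> proj3" using i less by (auto simp: proj3_def intro!: exI[of _ i])
      moreover have "P ?x" using v i scale[of "inverse (v $ i)" v] by simp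
      ultimately show "v \<in> (\<lambda>(c, x). c *s x) ` ((UNIV - {0}) \<times> ?X)"
        using i by (intro image_eqI[of _ _ "(v $ i, ?x)"]) auto
    qed (use nz scale in auto)
  qed
  then have "card ((UNIV - {0 :: 'a}) \<times> ?X) = card ({v. P v} - {0})"
    by (rule bij_betw_same_card)
  then have "card ({v. P v} - {0}) = (CARD('a) - 1) * card ?X"
    by (simp add: card_cartesian_product card_Diff_singleton)
  moreover have "card {v. P v} = Suc (card ({v. P v} - {0}))"
    by (rule card.remove) (use P0 in auto)
  ultimately show ?thesis by simp
qed

lemma elliptic_quadric_form:
  fixes X :: "('a::{field,finite} ^ 4) set"
  assumes "elliptic_quadric X"
  obtains f where "f \<in> forms2" "X = zero_set f" "elliptic_form (eval_form f)"
proof -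
  obtain f where f: "f \<in> forms2" "form_rank f = 4" and X: "X = zero_set f"
    using assms by (auto simp: elliptic_quadric_def)
  have cX: "card {x \<in> proj3. eval_form f x = 0} = CARD('a)\<^sup>2 + 1"
    using assms X by (simp add: elliptic_quadric_def zero_set_def)
  note Q = quadratic_map_eval_form[OF f(1)]
  have "card {v. eval_form f v = 0} = (CARD('a) - 1) * (CARD('a)\<^sup>2 + 1) + 1"
    unfolding cX[symmetric]
    by (rule card_proj3) (simp_all add: quadratic_map_zero[OF Q] quadratic_map_scale[OF Q])
  moreover obtain n where "CARD('a) = Suc n"
    using card_field_gt_1[where 'a = 'a] by (cases "CARD('a)") auto
  ultimately have "card {v. eval_form f v = 0} + CARD('a)\<^sup>2 = CARD('a) ^ 3 + CARD('a)"
    by (simp add: algebra_simps eval_nat_numeral)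
  then have "elliptic_form (eval_form f)"
    using Q form_rank_less_4[OF f(1)] f(2) by unfold_locales auto
  with f(1) X that show thesis by blast
qed

lemma weight_of_form:
  fixes X :: "('a::{field,finite} ^ 4) set"
  assumes X: "X = zero_set f" "card X = CARD('a)\<^sup>2 + 1" and f: "f \<in> forms2" and g: "g \<in> forms2"
    and N: "card {v. eval_form f v = 0 \<and> eval_form g v = 0} = (CARD('a) - 1) * k + 1"
  shows "weight X (restrict (eval_form g) X) + k = CARD('a)\<^sup>2 + 1"
proof -
  note Q = quadratic_map_eval_form
  have "card {v. eval_form f v = 0 \<and> eval_form g v = 0}
      = (CARD('a) - 1) * card {x \<in> proj3. eval_form f x = 0 \<and> eval_form g x = 0} + 1"
    by (rule card_proj3)
      (simp_all add: quadratic_map_zero[OF Q] quadratic_map_scale[OF Q] f g)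
  then have k: "card {x \<in> X. eval_form g x = 0} = k"
    using N card_field_gt_1[where 'a = 'a] by (simp add: X(1) zero_set_def conj_assoc)
  have "card ({x \<in> X. eval_form g x \<noteq> 0} \<union> {x \<in> X. eval_form g x = 0})
      = card {x \<in> X. eval_form g x \<noteq> 0} + card {x \<in> X. eval_form g x = 0}"
    by (rule card_Un_disjoint) auto
  moreover have "{x \<in> X. eval_form g x \<noteq> 0} \<union> {x \<in> X. eval_form g x = 0} = X" by auto
  moreover have "{x \<in> X. restrict (eval_form g) X x \<noteq> 0} = {x \<in> X. eval_form g x \<noteq> 0}" by auto
  ultimately show ?thesis using X(2) k by (simp add: weight_def)
qed

lemma nonzero_weights_ge:
  fixes X :: "('a::{field,finite} ^ 4) set"
  assumes "elliptic_quadric X" and w: "w \<in> nonzero_weights X"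
  shows "CARD('a)\<^sup>2 \<le> w + 2 * CARD('a) + 1"
proof -
  obtain f where f: "f \<in> forms2" and X: "X = zero_set f" and Q: "elliptic_form (eval_form f)"
    using elliptic_quadric_form[OF assms(1)] by blast
  obtain g where g: "g \<in> forms2" and wg: "w = weight X (restrict (eval_form g) X)" and "w \<noteq> 0"
    using w by (auto simp: nonzero_weights_def code2_def)
  define k where "k = card {x \<in> proj3. eval_form f x = 0 \<and> eval_form g x = 0}"
  have N: "card {v. eval_form f v = 0 \<and> eval_form g v = 0} = (CARD('a) - 1) * k + 1"
    unfolding k_def by (rule card_proj3)
      (simp_all add: quadratic_map_zero[OF quadratic_map_eval_form]
        quadratic_map_scale[OF quadratic_map_eval_form] f g)
  \<comment> \<open>A nonzero weight supplies a point of \<open>X\<close> off the second quadric, as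
    \<open>card_common_zeros_less\<close> requires.\<close>
  have "{x \<in> X. restrict (eval_form g) X x \<noteq> 0} \<noteq> {}"
    using \<open>w \<noteq> 0\<close> unfolding wg weight_def by (rule contrapos_nn) simp
  then obtain u where "eval_form f u = 0" "eval_form g u \<noteq> 0"
    by (auto simp: X zero_set_def)
  then have "(CARD('a) - 1) * k + 1 < 2 * CARD('a)\<^sup>2"
    using elliptic_form.card_common_zeros_less[OF Q quadratic_map_eval_form[OF g]] N by simp
  moreover obtain n where n: "CARD('a) = Suc (Suc n)"
    using card_field_gt_1[where 'a = 'a] by (auto simp: less_iff_Suc_add)
  \<comment> \<open>Here \<open>q = n + 2\<close>, and the right side is
    \<open>(q - 1) (2 q + 2) = 2 q^2 - 2\<close>, the largest value of \<open>(q - 1) k\<close> that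
    the strict bound permits.\<close>
  ultimately have "Suc n * k \<le> Suc n * (2 * n + 6)"
    by (simp add: algebra_simps eval_nat_numeral)
  then have "k \<le> 2 * CARD('a) + 2" unfolding Suc_mult_le_cancel1 using n by simp
  moreover have "w + k = CARD('a)\<^sup>2 + 1"
    unfolding wg using weight_of_form[OF X _ f g N] assms(1) by (simp add: elliptic_quadric_def)
  ultimately show ?thesis by simp
qed

lemma plane_pair_weight:
  fixes X :: "('a::{field,finite} ^ 4) set"
  assumes "elliptic_quadric X" and X: "X = zero_set f" and f: "f \<in> forms2"
    and lm: "linear_form l" "linear_form m"
    and N: "card {v. eval_form f v = 0 \<and> l v * m v = 0} = (CARD('a) - 1) * k + 1"
    and w: "w + k = CARD('a)\<^sup>2 + 1" "w \<noteq> 0"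
  shows "w \<in> nonzero_weights X"
proof -
  obtain g where g: "g \<in> forms2" "\<And>v. eval_form g v = l v * m v"
    using forms2_product[OF lm] by blast
  have "weight X (restrict (eval_form g) X) + k = CARD('a)\<^sup>2 + 1"
    using weight_of_form[OF X _ f g(1)] N assms(1) unfolding g(2) by (simp add: elliptic_quadric_def)
  then have "w = weight X (restrict (eval_form g) X)" using w(1) by simp
  then show ?thesis using w(2) g(1) by (auto simp: nonzero_weights_def code2_def)
qed

theorem theorem6p10:
  fixes X :: "('a::{field,finite} ^ 4) set" and q :: nat
  assumes "q = CARD('a)" and "q \<ge> 3" and "elliptic_quadric X"
  shows "is_kth_weight X 2 (q * (q - 2)) \<and> is_kth_weight X 3 ((q - 1)^2)"
proof -
  obtain f where f: "f \<in> forms2" and X: "X = zero_set f" and Q: "elliptic_form (eval_form f)"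
    using elliptic_quadric_form[OF assms(3)] by blast
  obtain n where n: "CARD('a) = n + 3"
    using assms(1,2) le_Suc_ex[of 3 q] by auto
  \<comment> \<open>With \<open>q = n + 3\<close> this is \<open>q^2 - 2 q - 1\<close>, the least
    weight, written without subtraction.\<close>
  define w where "w = n\<^sup>2 + 4 * n + 2"
  have ge: "w \<le> v" if "v \<in> nonzero_weights X" for v
    using nonzero_weights_ge[OF assms(3) that] unfolding n w_def
    by (simp add: power2_eq_square algebra_simps)
  note weight = plane_pair_weight[OF assms(3) X f, unfolded n]
  obtain l m where "linear_form l" "linear_form m"
    "card {v. eval_form f v = 0 \<and> l v * m v = 0} + 1 = 2 * (n + 3)\<^sup>2"
    by (rule elliptic_form.secant_plane_pair_external_axis[OF Q, unfolded n, OF le_add2]) (rule that)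
  \<comment> \<open>The argument \<open>2 n + 8\<close> is \<open>2 q + 2\<close>, the number of
    points of \<open>X\<close> on this pair; the next two pairs have one and two fewer.\<close>
  then have w1: "w \<in> nonzero_weights X"
    by (intro weight[of l m "2 * n + 8"]) (simp_all add: w_def power2_eq_square algebra_simps)
  obtain l m where "linear_form l" "linear_form m"
    "card {v. eval_form f v = 0 \<and> l v * m v = 0} + (n + 3) = 2 * (n + 3)\<^sup>2"
    by (rule elliptic_form.secant_plane_pair_tangent_axis[OF Q, unfolded n]) (rule that)
  then have w2: "w + 1 \<in> nonzero_weights X"
    by (intro weight[of l m "2 * n + 7"]) (simp_all add: w_def power2_eq_square algebra_simps)
  obtain l m where "linear_form l" "linear_form m"
    "card {v. eval_form f v = 0 \<and> l v * m v = 0} + 2 * (n + 3) = 2 * (n + 3)\<^sup>2 + 1"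
    by (rule elliptic_form.secant_plane_pair_secant_axis[OF Q, unfolded n]) (rule that)
  then have w3: "w + 2 \<in> nonzero_weights X"
    by (intro weight[of l m "2 * n + 6"]) (simp_all add: w_def power2_eq_square algebra_simps)
  \<comment> \<open>The attained weights are consecutive integers, so the lower bound
    \<open>w\<close> leaves no other weight below them.\<close>
  have "{v \<in> nonzero_weights X. v < w + 1} = {w}"
    using ge w1 by force
  moreover have "{v \<in> nonzero_weights X. v < w + 2} = {w, w + 1}"
    using ge w1 w2 by force
  moreover have "q * (q - 2) = w + 1" "(q - 1)\<^sup>2 = w + 2"
    unfolding assms(1) n w_def by (simp_all add: power2_eq_square algebra_simps)
  ultimately show ?thesis
    using w2 w3 by (simp add: is_kth_weight_def)
qed

end
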